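(* Let $n$ be a positive integer, $y\in\mathbb{C}$ and $\varepsilon\in\{1,-1\}$. Suppose that $F$ and $G$ are two entire functions with no common zeros which satisfy the functional equations $$F(z)=(-1)^nF(z+\pi)=\varepsilon\, q^{n/2}e^{2inz+2iy}F(z+\pi\tau)$$ and $$G(z)=(-1)^nG(z+\pi)=\varepsilon\, q^{n/2}e^{2inz}G(z+\pi\tau).$$ Suppose further that $G$ has only simple zeros and that $\mathcal{P}=\{a_1,a_2,\ldots,a_n\}$ is a complete set of inequivalent zeros of $G$. Then $$\frac{F(z)\,\theta_1(y|\tau)}{\theta_1'(0|\tau)\,G(z)}=\sum_{k=1}^{n}\frac{F(a_k)\,\theta_1(z+y-a_k|\tau)}{G'(a_k)\,\theta_1(z-a_k|\tau)}.$$
   Context: Fix $\tau\in\mathbb{C}$ with $\mathrm{Im}\,\tau>0$ and put $q=e^{2\pi i\tau}$, with $q^{s}=e^{2\pi i s\tau}$. The Jacobi theta function is the entire function $\theta_1(z|\tau)=2\sum_{n=0}^\infty(-1)^n q^{(2n+1)^2/8}\sin((2n+1)z)$; a prime denotes the derivative with respect to the (first) variable $z$. Let $\Lambda=\{m\pi+l\pi\tau:(m,l)\in\mathbb{Z}^2\}$. Two complex numbers are equivalent if their difference lies in $\Lambda$ and inequivalent otherwise. A complete set of inequivalent zeros of $G$ is a set of pairwise inequivalent zeros such that every zero of $G$ is equivalent to one of them. The identity is one of meromorphic functions of $z$. *)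

theory Defs
  imports "HOL-Complex_Analysis.Complex_Analysis"
begin

text \<open>The power \<open>q\<^sup>s\<close> of the nome is a function of \<open>\<tau>\<close> and \<open>s\<close>, not a branch of the power of \<open>q\<close>.\<close>

definition qpow :: "complex \<Rightarrow> complex \<Rightarrow> complex" where
  "qpow \<tau> s = exp (2 * of_real pi * \<i> * s * \<tau>)"

definition theta1 :: "complex \<Rightarrow> complex \<Rightarrow> complex" where
  "theta1 z \<tau> = 2 * (\<Sum>n. (-1) ^ n * qpow \<tau> ((2 * of_nat n + 1)\<^sup>2 / 8) * sin ((2 * of_nat n + 1) * z))"

definition period_lattice :: "complex \<Rightarrow> complex set" where
  "period_lattice \<tau> = {of_int m * of_real pi + of_int l * of_real pi * \<tau> | m l :: int. True}"

definition equivalent :: "complex \<Rightarrow> complex \<Rightarrow> complex \<Rightarrow> bool" where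
  "equivalent \<tau> z w \<longleftrightarrow> z - w \<in> period_lattice \<tau>"

definition complete_inequivalent_zeros :: "complex \<Rightarrow> (complex \<Rightarrow> complex) \<Rightarrow> complex set \<Rightarrow> bool" where
  "complete_inequivalent_zeros \<tau> G P \<longleftrightarrow>
     (\<forall>a\<in>P. G a = 0) \<and>
     (\<forall>a\<in>P. \<forall>b\<in>P. a \<noteq> b \<longrightarrow> \<not> equivalent \<tau> a b) \<and>
     (\<forall>z. G z = 0 \<longrightarrow> (\<exists>a\<in>P. equivalent \<tau> z a))"

end

theory Submission
  imports Defs
begin

text \<open>
  Both \<open>F / G\<close> and \<open>\<theta>\<^sub>1(z + y) / \<theta>\<^sub>1(z)\<close> have multipliers \<open>1\<close> and \<open>e\<^bsup>-2iy\<^esup>\<close> under the translations by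
  \<open>\<pi>\<close> and \<open>\<pi>\<tau>\<close>. If \<open>\<theta>\<^sub>1(y) \<noteq> 0\<close>, the residues of the two sides of the identity agree, so their difference
  is an entire function with these multipliers. An exponential factor makes the multipliers unimodular, and
  Liouville's theorem then shows that a nonzero difference would force \<open>y\<close> to be a period. If
  \<open>\<theta>\<^sub>1(y) = 0\<close>, then \<open>y = j\<pi> + l\<pi>\<tau>\<close>, and the claim is that the residues of the elliptic function
  \<open>e\<^bsup>2ilz\<^esup> F / G\<close> sum to zero: subtracting translates of \<open>\<theta>\<^sub>1' / \<theta>\<^sub>1\<close> leaves an entire function
  whose derivative is doubly periodic, hence constant.

  The zeros of \<open>\<theta>\<^sub>1\<close> are found, without the Jacobi triple product, by comparing it with a product
  of two solutions of \<open>E(w) = (1 - w) E(qw)\<close>. This product has the same multipliers as \<open>\<theta>\<^sub>1\<close>,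
  and its zeros are visibly simple and form the period lattice, so that Liouville's theorem applies to the quotient.
\<close>

section \<open>Entire functions and the period lattice\<close>

text \<open>At a zero \<open>w\<close> of \<open>g\<close> both functions are divided by
  \<open>z - w\<close>. Simplicity makes the reduced denominator nonzero at \<open>w\<close>, so the
  quotient extends holomorphically with value \<open>deriv f w / deriv g w\<close>.\<close>

lemma entire_quotient:
  assumes f: "f holomorphic_on UNIV" and g: "g holomorphic_on UNIV"
    and simple: "\<And>z. g z = 0 \<Longrightarrow> deriv g z \<noteq> 0"
    and zero: "\<And>z. g z = 0 \<Longrightarrow> f z = 0"
  obtains h where "h holomorphic_on UNIV" "\<And>z. f z = h z * g z"
proof
  define h where "h = (\<lambda>z. if g z = 0 then deriv f z / deriv g z else f z / g z)"
  show "f z = h z * g z" for z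
    using zero by (auto simp: h_def)
  have "h field_differentiable at w" for w
  proof (cases "g w = 0")
    case False
    have "open (g -` (-{0}))" (is "open ?U")
      by (rule open_vimage[OF _ holomorphic_on_imp_continuous_on[OF g]]) auto
    moreover have "(\<lambda>z. f z / g z) holomorphic_on ?U"
      by (intro holomorphic_on_divide holomorphic_on_subset[OF f] holomorphic_on_subset[OF g]) auto
    hence "h holomorphic_on ?U"
      by (rule holomorphic_transform) (auto simp: h_def)
    ultimately show ?thesis
      using holomorphic_on_imp_differentiable_at[of h ?U w] False by simp
  next
    case True
    define q where "q = (\<lambda>u :: complex \<Rightarrow> complex. \<lambda>z. if z = w then deriv u w else u z / (z - w))"
    have q: "q u holomorphic_on UNIV" if "u holomorphic_on UNIV" "u w = 0" for u
      by (rule pole_theorem_open_0[OF that(1), where a = w]) (auto simp: q_def that(2))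
    have qf: "q f holomorphic_on UNIV" and qg: "q g holomorphic_on UNIV"
      using q f g zero True by auto
    define U where "U = q g -` (-{0})"
    have "open U" unfolding U_def
      by (rule open_vimage[OF _ holomorphic_on_imp_continuous_on[OF qg]]) auto
    moreover have "w \<in> U" using simple[OF True] by (simp add: U_def q_def)
    moreover have "(\<lambda>z. q f z / q g z) holomorphic_on U"
      by (intro holomorphic_on_divide holomorphic_on_subset[OF qf] holomorphic_on_subset[OF qg]) (auto simp: U_def)
    hence "h holomorphic_on U"
    proof (rule holomorphic_transform)
      show "q f z / q g z = h z" if "z \<in> U" for z
        using that True by (auto simp: U_def q_def h_def split: if_splits)
    qed
    ultimately show ?thesis
      using holomorphic_on_imp_differentiable_at[of h U w] by simp
  qed
  thus "h holomorphic_on UNIV"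
    by (simp add: holomorphic_on_def field_differentiable_at_within)
qed

text \<open>If \<open>g\<close> vanished near a point, its derivative there would be 0; so the zeros
  of \<open>g\<close> have no interior, while the set where \<open>h\<close> is nonzero is open.
  This extends identities obtained by dividing by \<open>g\<close> to the zeros of
  \<open>g\<close>.\<close>

lemma simple_zeros_dense:
  fixes g h :: "complex \<Rightarrow> complex"
  assumes h: "continuous_on UNIV h"
    and simple: "\<And>z. g z = 0 \<Longrightarrow> deriv g z \<noteq> 0"
    and zero: "\<And>z. g z \<noteq> 0 \<Longrightarrow> h z = 0"
  shows "h z = 0"
proof (rule ccontr)
  assume nz: "h z \<noteq> 0"
  have "open (h -` (-{0}))"
    by (rule open_vimage[OF _ h]) auto
  moreover have "g w = 0" if "w \<in> h -` (-{0})" for w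
    using zero that by auto
  ultimately have "deriv g z = deriv (\<lambda>_. 0) z"
    using nz by (intro deriv_cong_ev) (auto simp: eventually_nhds)
  thus False
    using simple[of z] zero[of z] nz by auto
qed

text \<open>With equivalences as steps, integer induction runs in both directions along each period.
  Later instances of \<open>P\<close> are vanishing, simplicity of a zero, and a norm bound.\<close>

lemma period_lattice_induct:
  assumes v: "v \<in> period_lattice \<tau>"
    and pi: "\<And>z. P (z + of_real pi) \<longleftrightarrow> P z"
    and tau: "\<And>z. P (z + of_real pi * \<tau>) \<longleftrightarrow> P z"
  shows "P (z + v) \<longleftrightarrow> P z"
proof -
  have shift: "Q (z + of_int m * p) \<longleftrightarrow> Q z" if "\<And>z. Q (z + p) \<longleftrightarrow> Q z"
    for Q z m and p :: complex
  proof (induction m rule: int_induct[where k=0])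
    case (step1 i)
    thus ?case using that[of "z + of_int i * p"] by (simp add: algebra_simps)
  next
    case (step2 i)
    thus ?case using that[of "z + of_int (i - 1) * p"] by (simp add: algebra_simps)
  qed simp
  obtain m l where v: "v = of_int m * of_real pi + of_int l * of_real pi * \<tau>"
    using v by (auto simp: period_lattice_def)
  have "P (z + v) \<longleftrightarrow> P ((z + of_int m * of_real pi) + of_int l * (of_real pi * \<tau>))"
    by (simp add: v algebra_simps)
  also have "\<dots> \<longleftrightarrow> P z"
    using shift[of P] pi tau by simp
  finally show ?thesis .
qed

lemma period_cell:
  assumes "Im \<tau> \<noteq> 0"
  obtains v s t where "v \<in> period_lattice \<tau>" "s \<in> {0..1}" "t \<in> {0..1}"
    "z = (of_real s * of_real pi + of_real t * of_real pi * \<tau>) + v"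
proof -
  \<comment> \<open>\<open>s\<close> and \<open>t\<close> are the real coordinates of
    \<open>z\<close> in the basis \<open>pi\<close>, \<open>pi * \<tau>\<close>. Their floors give
    the lattice point, their fractional parts the point of the cell.\<close>
  define t where "t = Im z / (pi * Im \<tau>)"
  define s where "s = (Re z - t * pi * Re \<tau>) / pi"
  have z: "z = of_real s * of_real pi + of_real t * of_real pi * \<tau>"
    using assms by (simp add: complex_eq_iff s_def t_def)
  show ?thesis
  proof (rule that)
    show "of_int \<lfloor>s\<rfloor> * of_real pi + of_int \<lfloor>t\<rfloor> * of_real pi * \<tau> \<in> period_lattice \<tau>"
      by (auto simp: period_lattice_def)
    show "frac s \<in> {0..1}" "frac t \<in> {0..1}"
      by (auto simp: frac_lt_1 less_imp_le)
    show "z = (of_real (frac s) * of_real pi + of_real (frac t) * of_real pi * \<tau>) +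
              (of_int \<lfloor>s\<rfloor> * of_real pi + of_int \<lfloor>t\<rfloor> * of_real pi * \<tau>)"
      by (simp add: z frac_def algebra_simps)
  qed
qed

text \<open>A bound on the compact cell spreads to the plane, and Liouville applies. The period
  conditions concern the norm, so that unimodular multipliers are allowed, as in
  \<open>quasi_periodic_entire_zero\<close>.\<close>

lemma doubly_periodic_constant:
  assumes \<tau>: "Im \<tau> \<noteq> 0" and f: "f holomorphic_on UNIV"
    and pi: "\<And>z. norm (f (z + of_real pi)) = norm (f z)"
    and tau: "\<And>z. norm (f (z + of_real pi * \<tau>)) = norm (f z)"
  obtains c where "\<And>z. f z = c"
proof -
  define cell where "cell = (\<lambda>(s, t). of_real s * of_real pi + of_real t * of_real pi * \<tau>) ` ({0..1} \<times> {0..1::real})"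
  have "compact cell" unfolding cell_def case_prod_unfold
    by (intro compact_continuous_image continuous_intros compact_Times) auto
  hence "bounded (f ` cell)"
    using f by (intro compact_imp_bounded compact_continuous_image)
       (auto intro: holomorphic_on_imp_continuous_on holomorphic_on_subset)
  then obtain B where B: "\<And>z. z \<in> cell \<Longrightarrow> norm (f z) \<le> B"
    by (auto simp: bounded_iff)
  have "norm (f z) \<le> B" for z
  proof -
    obtain v s t where *: "v \<in> period_lattice \<tau>" "s \<in> {0..1}" "t \<in> {0..1}"
      and z: "z = (of_real s * of_real pi + of_real t * of_real pi * \<tau>) + v"
      using period_cell[OF \<tau>] by metis
    have "norm (f (of_real s * of_real pi + of_real t * of_real pi * \<tau>)) \<le> B"
      using * by (intro B) (auto simp: cell_def)
    thus ?thesis unfolding z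
      using period_lattice_induct[OF *(1), of "\<lambda>z. norm (f z) \<le> B"] by (simp add: pi tau)
  qed
  hence "bounded (range f)" by (auto simp: bounded_iff)
  hence "f constant_on UNIV" by (rule Liouville_theorem[OF f])
  thus ?thesis using that by (auto simp: constant_on_def)
qed

section \<open>Zeros of the theta function\<close>

lemma entire_power_series:
  fixes c r :: "nat \<Rightarrow> complex"
  assumes c: "\<And>n. c (Suc n) = r n * c n" and r: "r \<longlonglongrightarrow> 0"
  shows "summable (\<lambda>n. c n * w ^ n)" and "(\<lambda>w. \<Sum>n. c n * w ^ n) holomorphic_on UNIV"
proof -
  have *: "summable (\<lambda>n. c n * w ^ n)" for w
  proof -
    have "(\<lambda>n. norm (r n * w)) \<longlonglongrightarrow> norm (0 * w)"
      by (intro tendsto_intros r)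
    hence "eventually (\<lambda>n. norm (r n * w) < 1 / 2) sequentially"
      by (intro order_tendstoD) auto
    then obtain N where N: "\<And>n. n \<ge> N \<Longrightarrow> norm (r n * w) < 1 / 2"
      by (auto simp: eventually_sequentially)
    show ?thesis
    proof (rule summable_ratio_test)
      fix n assume "n \<ge> N"
      have "norm (c (Suc n) * w ^ Suc n) = norm (r n * w) * norm (c n * w ^ n)"
        by (simp add: c norm_mult)
      also have "\<dots> \<le> 1 / 2 * norm (c n * w ^ n)"
        using N[OF \<open>n \<ge> N\<close>] by (intro mult_right_mono) auto
      finally show "norm (c (Suc n) * w ^ Suc n) \<le> 1 / 2 * norm (c n * w ^ n)" .
    qed simp
  qed
  show "summable (\<lambda>n. c n * w ^ n)" by (rule *)
  show "(\<lambda>w. \<Sum>n. c n * w ^ n) holomorphic_on UNIV"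
    using termdiffs_strong_converges_everywhere[OF *]
    by (auto simp: holomorphic_on_open)
qed

text \<open>Comparing coefficients gives
  \<open>c (Suc n) * (1 - q ^ Suc n) = - (c n * q ^ n)\<close>, and the coefficient ratios tend to
  0. The solution is the product of all \<open>1 - q ^ n * w\<close>, obtained here as a power
  series.\<close>

lemma q_exponential_exists:
  assumes q: "norm (q :: complex) < 1"
  obtains E where "E holomorphic_on UNIV" "E 0 = 1" "\<And>w. E w = (1 - w) * E (q * w)"
proof -
  define r where "r = (\<lambda>n. - (q ^ n) / (1 - q ^ Suc n))"
  define c where "c = rec_nat 1 (\<lambda>n x. r n * x)"
  have c_Suc: "c (Suc n) = r n * c n" and c_0: "c 0 = 1" for n
    by (simp_all add: c_def)
  have lim: "(\<lambda>n. q ^ n) \<longlonglongrightarrow> 0"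
    using q by (rule LIMSEQ_power_zero)
  have "r \<longlonglongrightarrow> - 0 / (1 - 0)" unfolding r_def
    by (rule tendsto_divide[OF tendsto_minus[OF lim] tendsto_diff[OF tendsto_const LIMSEQ_Suc[OF lim]]]) simp
  hence r: "r \<longlonglongrightarrow> 0" by simp
  note summable = entire_power_series(1)[OF c_Suc r]
  define E where "E = (\<lambda>w. \<Sum>n. c n * w ^ n)"
  have rec: "c (Suc n) = c (Suc n) * q ^ Suc n - c n * q ^ n" for n
  proof -
    have "norm (q ^ Suc n) < 1"
      unfolding norm_power using q by (simp add: power_less_one_iff del: power_Suc)
    hence "1 - q ^ Suc n \<noteq> 0" by auto
    hence "c (Suc n) * (1 - q ^ Suc n) = - (c n * q ^ n)"
      by (simp add: c_Suc r_def)
    thus ?thesis by (simp add: algebra_simps)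
  qed
  have E: "E w = (1 - w) * E (q * w)" for w
  proof -
    have head: "E x = 1 + (\<Sum>n. c (Suc n) * x ^ Suc n)" for x
      using suminf_split_head[OF summable, of x] by (simp add: E_def c_0)
    have s1: "summable (\<lambda>n. c (Suc n) * (q * w) ^ Suc n)"
      using summable[of "q * w"] by (subst summable_Suc_iff)
    have s2: "summable (\<lambda>n. w * (c n * (q * w) ^ n))"
      by (intro summable_mult summable)
    have "c (Suc n) * w ^ Suc n = c (Suc n) * (q * w) ^ Suc n - w * (c n * (q * w) ^ n)" for n
    proof -
      have "c (Suc n) * w ^ Suc n = (c (Suc n) * q ^ Suc n - c n * q ^ n) * w ^ Suc n"
        using rec[of n] by simp
      also have "\<dots> = c (Suc n) * (q * w) ^ Suc n - w * (c n * (q * w) ^ n)"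
        by (simp add: algebra_simps power_mult_distrib)
      finally show ?thesis .
    qed
    hence "E w = 1 + (\<Sum>n. c (Suc n) * (q * w) ^ Suc n - w * (c n * (q * w) ^ n))"
      unfolding head by presburger
    also have "\<dots> = E (q * w) - w * E (q * w)"
    proof -
      have "(\<Sum>n. w * (c n * (q * w) ^ n)) = w * E (q * w)"
        unfolding E_def by (rule suminf_mult[OF summable])
      thus ?thesis
        using suminf_diff[OF s1 s2] head[of "q * w"] by (simp only: add_diff_eq[symmetric])
    qed
    finally show ?thesis by (simp add: algebra_simps)
  qed
  show ?thesis
  proof (rule that[OF _ _ E])
    show "E holomorphic_on UNIV"
      unfolding E_def by (rule entire_power_series(2)[OF c_Suc r])
    show "E 0 = 1"
      unfolding E_def powser_zero by (rule c_0)
  qed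
qed

text \<open>As long as no factor \<open>1 - q ^ n * w\<close> vanishes, the equation passes the zero
  on from \<open>w\<close> to every \<open>q ^ n * w\<close>. These points tend to 0, which
  contradicts \<open>E 0 = 1\<close> by continuity.\<close>

lemma q_exponential_zeros:
  assumes q: "norm (q :: complex) < 1" and E: "E holomorphic_on UNIV" "E 0 = (1 :: complex)"
    "\<And>w. E w = (1 - w) * E (q * w)" and w: "E w = 0"
  obtains n :: nat where "q ^ n * w = 1"
proof -
  have "\<exists>n. q ^ n * w = 1"
  proof (rule ccontr)
    assume *: "\<nexists>n. q ^ n * w = 1"
    have zero: "E (q ^ n * w) = 0" for n
    proof (induction n)
      case (Suc n)
      thus ?case using E(3)[of "q ^ n * w"] * by (auto simp: mult.assoc)
    qed (simp add: w)
    have "(\<lambda>n. q ^ n * w) \<longlonglongrightarrow> 0 * w"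
      by (intro tendsto_intros LIMSEQ_power_zero q)
    moreover have "isCont E 0"
      using holomorphic_on_imp_continuous_on[OF E(1)] by (simp add: continuous_on_eq_continuous_at)
    ultimately have "(\<lambda>n. E (q ^ n * w)) \<longlonglongrightarrow> E 0"
      by (intro isCont_tendsto_compose[of 0 E]) auto
    thus False by (simp add: zero E(2) LIMSEQ_const_iff)
  qed
  thus ?thesis using that by blast
qed

text \<open>Differentiating the functional equation gives
  \<open>m z * deriv f z + deriv m z * f z\<close>, whose second term drops out at a zero.\<close>

lemma simple_zero_shift:
  fixes f m :: "complex \<Rightarrow> complex"
  assumes f: "f holomorphic_on UNIV" and m: "m holomorphic_on UNIV" "\<And>z. m z \<noteq> 0"
    and shift: "\<And>z. f (z + p) = m z * f z"
  shows "f (z + p) = 0 \<and> deriv f (z + p) \<noteq> 0 \<longleftrightarrow> f z = 0 \<and> deriv f z \<noteq> 0"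
proof -
  have "((\<lambda>z. f (z + p)) has_field_derivative deriv f (z + p)) (at z)"
    using holomorphic_derivI[OF f open_UNIV UNIV_I, of "z + p"] DERIV_shift by blast
  moreover have "((\<lambda>z. m z * f z) has_field_derivative (m z * deriv f z + deriv m z * f z)) (at z)"
    using holomorphic_derivI[OF f, of z] holomorphic_derivI[OF m(1), of z]
    by (auto intro!: derivative_eq_intros)
  ultimately have "deriv f (z + p) = m z * deriv f z + deriv m z * f z"
    using shift by (simp add: DERIV_unique)
  thus ?thesis using m(2)[of z] shift[of z] by auto
qed

text \<open>\<open>P\<close> is the product side of the Jacobi triple product, up to a factor
  independent of \<open>z\<close>. The prefactor \<open>exp (\<i> * z)\<close> produces the sign
  change under \<open>pi\<close>.\<close>

lemma lattice_function_exists: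
  assumes \<tau>: "Im \<tau> > 0"
  obtains P where "P holomorphic_on UNIV"
    "\<And>z. P (z + of_real pi) = - P z"
    "\<And>z. P (z + of_real pi * \<tau>) = - exp (- \<i> * pi * \<tau> - 2 * \<i> * z) * P z"
    "\<And>z. P z = 0 \<longleftrightarrow> z \<in> period_lattice \<tau>"
    "\<And>z. P z = 0 \<Longrightarrow> deriv P z \<noteq> 0"
proof -
  define q where "q = exp (2 * \<i> * pi * \<tau>)"
  have q: "norm q < 1" "q \<noteq> 0" using \<tau> by (simp_all add: q_def)
  obtain E where E: "E holomorphic_on UNIV" "E 0 = 1" "\<And>w. E w = (1 - w) * E (q * w)"
    using q_exponential_exists[OF q(1)] by blast
  define P where "P = (\<lambda>z. exp (\<i> * z) * E (exp (- (2 * \<i> * z))) * E (q * exp (2 * \<i> * z)))"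
  have compose: "(\<lambda>z. E (h z)) holomorphic_on UNIV" if "h holomorphic_on UNIV" for h
    using holomorphic_on_compose_gen[OF that E(1)] by (simp add: o_def)
  have P: "P holomorphic_on UNIV" unfolding P_def
    by (intro holomorphic_intros compose)
  have P_pi: "P (z + of_real pi) = - P z" for z
  proof -
    have x: "exp (\<i> * (z + pi)) = - exp (\<i> * z)"
      by (simp add: exp_add distrib_left)
    have w: "exp (2 * \<i> * u) = exp (\<i> * u) ^ 2" for u
      using exp_double[of "\<i> * u"] by (simp add: mult.assoc)
    show ?thesis by (simp add: P_def exp_minus w x)
  qed
  have P_tau: "P (z + of_real pi * \<tau>) = - exp (- \<i> * pi * \<tau> - 2 * \<i> * z) * P z" for z
  proof -
    define t x where "t = exp (\<i> * pi * \<tau>)" and "x = exp (\<i> * z)"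
    have nz: "t \<noteq> 0" "x \<noteq> 0" by (simp_all add: t_def x_def)
    have q: "q = t\<^sup>2"
      using exp_double[of "\<i> * pi * \<tau>"] by (simp add: q_def t_def mult.assoc)
    have w: "exp (2 * \<i> * u) = exp (\<i> * u) ^ 2" for u
      using exp_double[of "\<i> * u"] by (simp add: mult.assoc)
    have x: "exp (\<i> * (z + pi * \<tau>)) = x * t"
      by (simp add: x_def t_def exp_add distrib_left mult.assoc)
    have mult: "exp (- \<i> * pi * \<tau> - 2 * \<i> * z) = inverse (t * x\<^sup>2)"
      by (simp add: exp_diff exp_minus w x_def t_def divide_inverse)
    \<comment> \<open>Translation by \<open>pi * \<tau>\<close> turns \<open>x\<close> into
      \<open>x * t\<close>. The functional equation is applied once to each factor, in opposite
      directions, and the resulting linear factors combine to the multiplier.\<close>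
    have 1: "E (inverse ((x * t)\<^sup>2)) = (1 - inverse ((x * t)\<^sup>2)) * E (inverse (x\<^sup>2))"
    proof -
      have "q * inverse ((x * t)\<^sup>2) = inverse (x\<^sup>2)"
        using nz by (simp add: q field_simps)
      thus ?thesis using E(3)[of "inverse ((x * t)\<^sup>2)"] by simp
    qed
    have 2: "E (q * x\<^sup>2) = (1 - (x * t)\<^sup>2) * E (q * (x * t)\<^sup>2)"
      using E(3)[of "q * x\<^sup>2"] by (simp add: q power_mult_distrib mult_ac)
    have "P (z + of_real pi * \<tau>) = x * t * E (inverse ((x * t)\<^sup>2)) * E (q * (x * t)\<^sup>2)"
      by (simp add: P_def exp_minus w x)
    also have "\<dots> = x * t * (1 - inverse ((x * t)\<^sup>2)) * E (inverse (x\<^sup>2)) * E (q * (x * t)\<^sup>2)"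
      by (simp only: 1 mult.assoc)
    also have "x * t * (1 - inverse ((x * t)\<^sup>2)) = - inverse (t * x\<^sup>2) * x * (1 - (x * t)\<^sup>2)"
      using nz by (simp add: field_simps power2_eq_square)
    also have "\<dots> * E (inverse (x\<^sup>2)) * E (q * (x * t)\<^sup>2) =
               - inverse (t * x\<^sup>2) * (x * E (inverse (x\<^sup>2)) * E (q * x\<^sup>2))"
      unfolding 2 by (simp only: mult_ac)
    also have "x * E (inverse (x\<^sup>2)) * E (q * x\<^sup>2) = P z"
      by (simp add: P_def exp_minus w x_def)
    finally show ?thesis by (simp only: mult)
  qed
  have zero: "z \<in> period_lattice \<tau>" if "P z = 0" for z
  proof -
    have qn: "q ^ n = exp (of_nat n * (2 * \<i> * pi * \<tau>))" for n
      by (simp add: q_def exp_of_nat_mult)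
    have "E (exp (- (2 * \<i> * z))) = 0 \<or> E (q * exp (2 * \<i> * z)) = 0"
      using that by (simp add: P_def)
    \<comment> \<open>The first factor accounts for \<open>k \<ge> 0\<close> and the second, because
      of its extra \<open>q\<close>, for \<open>k = - (n + 1)\<close>.\<close>
    hence "\<exists>k :: int. exp (2 * \<i> * (of_int k * pi * \<tau> - z)) = 1"
    proof
      assume "E (exp (- (2 * \<i> * z))) = 0"
      then obtain n where "q ^ n * exp (- (2 * \<i> * z)) = 1"
        by (rule q_exponential_zeros[OF q(1) E])
      hence "exp (2 * \<i> * (of_int (int n) * pi * \<tau> - z)) = 1"
        unfolding qn exp_add[symmetric] by (simp add: algebra_simps)
      thus ?thesis by blast
    next
      assume "E (q * exp (2 * \<i> * z)) = 0"
      then obtain n where "q ^ n * (q * exp (2 * \<i> * z)) = 1"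
        by (rule q_exponential_zeros[OF q(1) E])
      hence "q ^ Suc n * exp (2 * \<i> * z) = 1"
        by (simp only: power_Suc2 mult.assoc)
      hence "exp (- (2 * \<i> * (of_int (- int (Suc n)) * pi * \<tau> - z))) = 1"
        unfolding qn exp_add[symmetric] by (simp add: algebra_simps)
      hence "exp (2 * \<i> * (of_int (- int (Suc n)) * pi * \<tau> - z)) = 1"
        unfolding exp_minus by simp
      thus ?thesis by blast
    qed
    then obtain k :: int where k: "exp (2 * \<i> * (of_int k * pi * \<tau> - z)) = 1"
      by blast
    have exp1: "\<exists>j :: int. u = of_int (2 * j) * pi * \<i>" if "exp u = 1" for u
    proof -
      obtain j :: int where "Re u = 0" "Im u = of_int (2 * j) * pi"
        using \<open>exp u = 1\<close> unfolding exp_eq_1 by blast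
      hence "u = of_int (2 * j) * pi * \<i>"
        by (simp add: complex_eq_iff)
      thus ?thesis by blast
    qed
    from exp1[OF k] obtain j :: int where *: "2 * \<i> * (of_int k * pi * \<tau> - z) = of_int (2 * j) * pi * \<i>"
      by blast
    have "2 * \<i> * (of_int k * pi * \<tau> - z) = 2 * \<i> * (of_int j * pi)"
      unfolding * by simp
    hence "of_int k * pi * \<tau> - z = of_int j * pi"
      by (subst (asm) mult_cancel_left) simp
    hence "z = of_int (- j) * of_real pi + of_int k * of_real pi * \<tau>"
      by (simp add: algebra_simps)
    thus ?thesis unfolding period_lattice_def by blast
  qed
  have simple: "P z = 0 \<and> deriv P z \<noteq> 0" if "z \<in> period_lattice \<tau>" for z
  proof -
    have "E q \<noteq> 0"
    proof
      assume "E q = 0"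
      then obtain n where "q ^ n * q = 1"
        by (rule q_exponential_zeros[OF q(1) E])
      moreover have "norm (q ^ Suc n) < 1"
        unfolding norm_power using q by (simp add: power_less_one_iff del: power_Suc)
      ultimately show False by (simp add: mult.commute)
    qed
    \<comment> \<open>One use of the functional equation extracts the factor of \<open>P\<close>
      that vanishes at 0. The cofactor \<open>R\<close> has \<open>R 0 = E q * E q\<close>, so the
      zero at 0 is simple; the multipliers carry this to the whole lattice.\<close>
    define R where "R = (\<lambda>z. E (q * exp (- (2 * \<i> * z))) * E (q * exp (2 * \<i> * z)))"
    have "R holomorphic_on UNIV"
      unfolding R_def by (intro holomorphic_intros compose)
    hence R: "(R has_field_derivative deriv R 0) (at 0)"
      by (rule holomorphic_derivI) auto
    have P_eq: "P z = (exp (\<i> * z) - exp (- (\<i> * z))) * R z" for z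
    proof -
      have "exp (\<i> * z) * (1 - exp (- (2 * \<i> * z))) = exp (\<i> * z) - exp (- (\<i> * z))"
        by (simp add: right_diff_distrib flip: exp_add)
      thus ?thesis
        using E(3)[of "exp (- (2 * \<i> * z))"] by (simp add: P_def R_def mult.assoc[symmetric])
    qed
    have "((\<lambda>z. (exp (\<i> * z) - exp (- (\<i> * z))) * R z) has_field_derivative 2 * \<i> * R 0) (at 0)"
      by (rule derivative_eq_intros R refl | simp)+
    hence "deriv P 0 = 2 * \<i> * R 0"
      unfolding P_eq[symmetric] by (rule DERIV_imp_deriv)
    hence "P 0 = 0 \<and> deriv P 0 \<noteq> 0"
      using \<open>E q \<noteq> 0\<close> by (simp add: P_eq R_def)
    moreover have "P (0 + z) = 0 \<and> deriv P (0 + z) \<noteq> 0 \<longleftrightarrow> P 0 = 0 \<and> deriv P 0 \<noteq> 0"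
    proof (rule period_lattice_induct[OF that, where P = "\<lambda>z. P z = 0 \<and> deriv P z \<noteq> 0"])
      show "P (u + pi) = 0 \<and> deriv P (u + pi) \<noteq> 0 \<longleftrightarrow> P u = 0 \<and> deriv P u \<noteq> 0" for u :: complex
        by (rule simple_zero_shift[OF P, of "\<lambda>_. -1"]) (auto simp: P_pi)
      show "P (u + pi * \<tau>) = 0 \<and> deriv P (u + pi * \<tau>) \<noteq> 0 \<longleftrightarrow> P u = 0 \<and> deriv P u \<noteq> 0" for u :: complex
        by (rule simple_zero_shift[OF P _ _ P_tau]) (auto intro!: holomorphic_intros)
    qed
    ultimately show ?thesis by simp
  qed
  have iff: "P z = 0 \<longleftrightarrow> z \<in> period_lattice \<tau>" for z
    using zero simple by blast
  have simple': "deriv P z \<noteq> 0" if "P z = 0" for z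
    using zero simple that by blast
  show ?thesis by (rule that[OF P P_pi P_tau iff simple'])
qed

text \<open>The quotient \<open>f / g\<close> is entire and the common multiplier \<open>t\<close>
  cancels, so it is an elliptic function without poles.\<close>

lemma same_multipliers_proportional:
  assumes \<tau>: "Im \<tau> \<noteq> 0"
    and f: "f holomorphic_on UNIV" and g: "g holomorphic_on UNIV"
    and simple: "\<And>z. g z = 0 \<Longrightarrow> deriv g z \<noteq> 0"
    and zero: "\<And>z. g z = 0 \<Longrightarrow> f z = 0"
    and shift: "\<And>p z. p \<in> {of_real pi, of_real pi * \<tau>} \<Longrightarrow> f (z + p) = t p z * f z"
      "\<And>p z. p \<in> {of_real pi, of_real pi * \<tau>} \<Longrightarrow> g (z + p) = t p z * g z"
      "\<And>p z. p \<in> {of_real pi, of_real pi * \<tau>} \<Longrightarrow> t p z \<noteq> 0"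
  obtains c where "\<And>z. f z = c * g z"
proof -
  obtain h where h: "h holomorphic_on UNIV" "\<And>z. f z = h z * g z"
    using entire_quotient[OF f g simple zero] by blast
  have cont: "continuous_on UNIV h"
    using h(1) by (rule holomorphic_on_imp_continuous_on)
  have per: "h (z + p) = h z" if p: "p \<in> {of_real pi, of_real pi * \<tau>}" for p z
  proof -
    have "h (z + p) - h z = 0"
    proof (rule simple_zeros_dense[OF _ simple, where h = "\<lambda>z. h (z + p) - h z"])
      show "continuous_on UNIV (\<lambda>z. h (z + p) - h z)"
        by (intro continuous_intros continuous_on_compose2[OF cont]) auto
      show "h (z + p) - h z = 0" if "g z \<noteq> 0" for z
      proof -
        have "h (z + p) * (t p z * g z) = t p z * (h z * g z)"
          using shift[OF p, of z] h(2)[of z] h(2)[of "z + p"] by simp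
        thus ?thesis using that shift(3)[OF p, of z] by simp
      qed
    qed
    thus ?thesis by simp
  qed
  obtain c where "\<And>z. h z = c"
    using doubly_periodic_constant[OF \<tau> h(1)] per by (metis insertI1 insertI2)
  hence "\<And>z. f z = c * g z" using h(2) by simp
  thus ?thesis by (rule that)
qed

text \<open>The terms with \<open>e\<^bsup>(2n+1)iz\<^esup>\<close> and with \<open>e\<^bsup>-(2n+1)iz\<^esup>\<close> are summed separately, each as a power
  series \<open>a\<close> in \<open>w = e\<^bsup>\<plusminus>2iz\<^esup>\<close>. The translation by \<open>\<pi>\<tau>\<close> becomes \<open>w \<mapsto> q w\<close>, and the two boundary
  terms \<open>c\<close> cancel.\<close>

lemma theta1_half_series:
  assumes \<tau>: "Im \<tau> > 0"
  obtains a c where "a holomorphic_on UNIV" "c \<noteq> 0"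
    "\<And>w. a w = c - exp (2 * \<i> * pi * \<tau>) * w * a (exp (2 * \<i> * pi * \<tau>) * w)"
    "\<And>z. theta1 z \<tau> = - \<i> * (exp (\<i> * z) * a (exp (2 * \<i> * z)) - exp (- (\<i> * z)) * a (exp (- (2 * \<i> * z))))"
proof -
  define q where "q = exp (2 * \<i> * pi * \<tau>)"
  have q: "norm q < 1" using \<tau> by (simp add: q_def)
  define c where "c = (\<lambda>n::nat. (-1) ^ n * qpow \<tau> ((2 * of_nat n + 1)\<^sup>2 / 8))"
  \<comment> \<open>The exponents \<open>(2 * n + 3)\<^sup>2 / 8\<close> and
    \<open>(2 * n + 1)\<^sup>2 / 8\<close> differ by exactly \<open>n + 1\<close>.\<close>
  have c_Suc: "c (Suc n) = - (q ^ Suc n) * c n" for n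
  proof -
    have "qpow \<tau> ((2 * of_nat (Suc n) + 1)\<^sup>2 / 8) =
      exp (of_nat (Suc n) * (2 * \<i> * pi * \<tau>) + 2 * of_real pi * \<i> * ((2 * of_nat n + 1)\<^sup>2 / 8) * \<tau>)"
      unfolding qpow_def by (rule arg_cong[of _ _ exp]) (simp add: field_simps power2_eq_square)
    also have "\<dots> = q ^ Suc n * qpow \<tau> ((2 * of_nat n + 1)\<^sup>2 / 8)"
      by (simp only: exp_add exp_of_nat_mult q_def qpow_def)
    finally show ?thesis by (simp add: c_def)
  qed
  have r: "(\<lambda>n. - (q ^ Suc n)) \<longlonglongrightarrow> 0"
    using tendsto_minus[OF LIMSEQ_Suc[OF LIMSEQ_power_zero[OF q]]] by simp
  note summable = entire_power_series(1)[OF c_Suc r]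
  define a where "a = (\<lambda>w. \<Sum>n. c n * w ^ n)"
  show ?thesis
  proof (rule that[of a "c 0"])
    show "a holomorphic_on UNIV"
      unfolding a_def by (rule entire_power_series(2)[OF c_Suc r])
    show "c 0 \<noteq> 0" by (simp add: c_def qpow_def)
    fix w
    have "a w = c 0 + (\<Sum>n. c (Suc n) * w ^ Suc n)"
      using suminf_split_head[OF summable, of w] by (simp add: a_def)
    also have "(\<lambda>n. c (Suc n) * w ^ Suc n) = (\<lambda>n. - (q * w) * (c n * (q * w) ^ n))"
      by (simp add: c_Suc power_mult_distrib mult_ac)
    also have "(\<Sum>n. - (q * w) * (c n * (q * w) ^ n)) = - (q * w) * a (q * w)"
      unfolding a_def by (rule suminf_mult[OF summable])
    finally show "a w = c 0 - exp (2 * \<i> * pi * \<tau>) * w * a (exp (2 * \<i> * pi * \<tau>) * w)"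
      by (simp add: q_def)
  next
    fix z
    have e: "exp (\<i> * u) * (c n * exp (2 * \<i> * u) ^ n) = c n * exp (\<i> * ((2 * of_nat n + 1) * u))" for u n
    proof -
      have "exp (\<i> * ((2 * of_nat n + 1) * u)) = exp (\<i> * u + of_nat n * (2 * \<i> * u))"
        by (simp add: algebra_simps)
      also have "\<dots> = exp (\<i> * u) * exp (2 * \<i> * u) ^ n"
        by (simp only: exp_add exp_of_nat_mult)
      finally show ?thesis by (simp only: mult.left_commute)
    qed
    have summ: "summable (\<lambda>n. c n * exp (\<i> * ((2 * of_nat n + 1) * u)))"
      and sum: "exp (\<i> * u) * a (exp (2 * \<i> * u)) = (\<Sum>n. c n * exp (\<i> * ((2 * of_nat n + 1) * u)))" for u
    proof -
      show "summable (\<lambda>n. c n * exp (\<i> * ((2 * of_nat n + 1) * u)))"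
        unfolding e[symmetric] by (rule summable_mult[OF summable])
      show "exp (\<i> * u) * a (exp (2 * \<i> * u)) = (\<Sum>n. c n * exp (\<i> * ((2 * of_nat n + 1) * u)))"
        unfolding e[symmetric] a_def by (rule suminf_mult[OF summable, symmetric])
    qed
    have "theta1 z \<tau> = 2 * (\<Sum>n. (- \<i> / 2) * (c n * exp (\<i> * ((2 * of_nat n + 1) * z)) - c n * exp (\<i> * ((2 * of_nat n + 1) * - z))))"
      unfolding theta1_def c_def sin_exp_eq
      by (intro arg_cong[of _ _ "\<lambda>f. 2 * suminf f"] ext) (simp add: field_simps)
    also have "\<dots> = - \<i> * (\<Sum>n. c n * exp (\<i> * ((2 * of_nat n + 1) * z)) - c n * exp (\<i> * ((2 * of_nat n + 1) * - z)))"
      using suminf_mult[OF summable_diff[OF summ[of z] summ[of "- z"]], of "- \<i> / 2"] by simp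
    also have "\<dots> = - \<i> * (exp (\<i> * z) * a (exp (2 * \<i> * z)) - exp (\<i> * - z) * a (exp (2 * \<i> * - z)))"
      unfolding sum suminf_diff[OF summ summ] ..
    finally show "theta1 z \<tau> = - \<i> * (exp (\<i> * z) * a (exp (2 * \<i> * z)) - exp (- (\<i> * z)) * a (exp (- (2 * \<i> * z))))"
      by simp
  qed
qed

section \<open>Parity, translation behaviour and zeros of \<open>theta1\<close>\<close>

lemma theta1_minus:
  assumes "Im \<tau> > 0"
  shows "theta1 (- z) \<tau> = - theta1 z \<tau>"
proof -
  obtain a :: "complex \<Rightarrow> complex" where
    "\<And>z. theta1 z \<tau> = - \<i> * (exp (\<i> * z) * a (exp (2 * \<i> * z)) - exp (- (\<i> * z)) * a (exp (- (2 * \<i> * z))))"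
    using theta1_half_series[OF assms] by metis
  thus ?thesis by (simp add: right_diff_distrib)
qed

lemma theta1_holomorphic:
  assumes "Im \<tau> > 0"
  shows "(\<lambda>z. theta1 z \<tau>) holomorphic_on UNIV"
proof -
  obtain a c where a: "a holomorphic_on UNIV" and theta:
    "\<And>z. theta1 z \<tau> = - \<i> * (exp (\<i> * z) * a (exp (2 * \<i> * z)) - exp (- (\<i> * z)) * a (exp (- (2 * \<i> * z))))"
    using theta1_half_series[OF assms] by metis
  have compose: "(\<lambda>z. a (h z)) holomorphic_on UNIV" if "h holomorphic_on UNIV" for h
    using holomorphic_on_compose_gen[OF that a] by (simp add: o_def)
  show ?thesis unfolding theta
    by (intro holomorphic_intros compose)
qed

lemma theta1_add_pi:
  assumes "Im \<tau> > 0"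
  shows "theta1 (z + of_real pi) \<tau> = - theta1 z \<tau>"
proof -
  have x: "exp (\<i> * (z + pi)) = - exp (\<i> * z)"
    by (simp add: exp_add distrib_left)
  have w: "exp (2 * \<i> * u) = exp (\<i> * u) ^ 2" for u
    using exp_double[of "\<i> * u"] by (simp add: mult.assoc)
  obtain a :: "complex \<Rightarrow> complex" where
    "\<And>z. theta1 z \<tau> = - \<i> * (exp (\<i> * z) * a (exp (2 * \<i> * z)) - exp (- (\<i> * z)) * a (exp (- (2 * \<i> * z))))"
    using theta1_half_series[OF assms] by metis
  thus ?thesis by (simp add: exp_minus w x right_diff_distrib)
qed

lemma theta1_add_pi_tau:
  assumes "Im \<tau> > 0"
  shows "theta1 (z + of_real pi * \<tau>) \<tau> = - exp (- \<i> * pi * \<tau> - 2 * \<i> * z) * theta1 z \<tau>"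
proof -
  obtain a c where a: "\<And>w. a w = c - exp (2 * \<i> * pi * \<tau>) * w * a (exp (2 * \<i> * pi * \<tau>) * w)"
    and theta: "\<And>z. theta1 z \<tau> = - \<i> * (exp (\<i> * z) * a (exp (2 * \<i> * z)) - exp (- (\<i> * z)) * a (exp (- (2 * \<i> * z))))"
    using theta1_half_series[OF assms] by metis
  define t x where "t = exp (\<i> * pi * \<tau>)" and "x = exp (\<i> * z)"
  have nz: "t \<noteq> 0" "x \<noteq> 0" by (simp_all add: t_def x_def)
  have q: "exp (2 * \<i> * pi * \<tau>) = t\<^sup>2"
    using exp_double[of "\<i> * pi * \<tau>"] by (simp add: t_def mult.assoc)
  have w: "exp (2 * \<i> * u) = exp (\<i> * u) ^ 2" for u
    using exp_double[of "\<i> * u"] by (simp add: mult.assoc)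
  have x: "exp (\<i> * (z + pi * \<tau>)) = x * t"
    by (simp add: x_def t_def exp_add distrib_left mult.assoc)
  have mult: "exp (- \<i> * pi * \<tau> - 2 * \<i> * z) = inverse (t * x\<^sup>2)"
    by (simp add: exp_diff exp_minus w x_def t_def divide_inverse)
  have 1: "a (x\<^sup>2) = c - (x * t)\<^sup>2 * a ((x * t)\<^sup>2)"
    using a[of "x\<^sup>2"] unfolding q by (simp add: power_mult_distrib mult.commute)
  have 2: "a (inverse ((x * t)\<^sup>2)) = c - inverse (x\<^sup>2) * a (inverse (x\<^sup>2))"
  proof -
    have "t\<^sup>2 * inverse ((x * t)\<^sup>2) = inverse (x\<^sup>2)"
      using nz by (simp add: field_simps)
    thus ?thesis using a[of "inverse ((x * t)\<^sup>2)"] by (simp add: q)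
  qed
  have "theta1 (z + of_real pi * \<tau>) \<tau> =
      - \<i> * (x * t * a ((x * t)\<^sup>2) - inverse (x * t) * a (inverse ((x * t)\<^sup>2)))"
    unfolding theta by (simp only: exp_minus w x)
  also have "\<dots> = - inverse (t * x\<^sup>2) * (- \<i> * (x * a (x\<^sup>2) - inverse x * a (inverse (x\<^sup>2))))"
    unfolding 1 2 using nz by (simp add: field_simps power2_eq_square)
  also have "- \<i> * (x * a (x\<^sup>2) - inverse x * a (inverse (x\<^sup>2))) = theta1 z \<tau>"
    unfolding theta by (simp only: exp_minus w x_def)
  finally show ?thesis by (simp only: mult)
qed

text \<open>This keeps the constant relating \<open>theta1\<close> to the lattice product from being
  0. If \<open>theta1\<close> vanished, its two half series would agree, and Liouville would make
  them constant.\<close>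

lemma theta1_not_identically_0:
  assumes \<tau>: "Im \<tau> > 0"
  obtains z where "theta1 z \<tau> \<noteq> 0"
proof -
  have "\<exists>z. theta1 z \<tau> \<noteq> 0"
  proof (rule ccontr)
    assume *: "\<nexists>z. theta1 z \<tau> \<noteq> 0"
    obtain a c where a: "a holomorphic_on UNIV" "c \<noteq> 0"
      "\<And>w. a w = c - exp (2 * \<i> * pi * \<tau>) * w * a (exp (2 * \<i> * pi * \<tau>) * w)"
      and theta: "\<And>z. theta1 z \<tau> = - \<i> * (exp (\<i> * z) * a (exp (2 * \<i> * z)) - exp (- (\<i> * z)) * a (exp (- (2 * \<i> * z))))"
      using theta1_half_series[OF \<tau>] by blast
    define A where "A = (\<lambda>z. exp (\<i> * z) * a (exp (2 * \<i> * z)))"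
    have even: "A (- z) = A z" for z
      using * theta[of z] by (simp add: A_def)
    have "(\<lambda>z. a (exp (2 * \<i> * z))) holomorphic_on UNIV"
      by (rule holomorphic_on_compose_gen[OF _ a(1), unfolded o_def]) (auto intro!: holomorphic_intros)
    hence A: "A holomorphic_on UNIV"
      unfolding A_def by (intro holomorphic_intros)
    \<comment> \<open>\<open>A\<close> is bounded on the upper half plane, where \<open>\<bar>e\<^bsup>iz\<^esup>\<bar> \<le> 1\<close>, and it is even if \<open>\<theta>\<^sub>1 = 0\<close>.\<close>
    have "bounded (a ` cball 0 1)"
      by (intro compact_imp_bounded compact_continuous_image compact_cball
          continuous_on_subset[OF holomorphic_on_imp_continuous_on[OF a(1)]]) simp
    then obtain B where B: "\<And>w. norm w \<le> 1 \<Longrightarrow> norm (a w) \<le> B"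
      unfolding bounded_iff by (metis image_eqI mem_cball_0)
    have upper: "norm (A z) \<le> B" if "Im z \<ge> 0" for z
    proof -
      have "norm (A z) \<le> 1 * B" unfolding A_def norm_mult
        using that by (intro mult_mono B) auto
      thus ?thesis by simp
    qed
    have "norm (A z) \<le> B" for z
      using upper[of z] upper[of "- z"] by (cases "Im z \<ge> 0") (auto simp: even)
    hence "bounded (range A)" by (auto simp: bounded_iff)
    hence "A constant_on UNIV" by (rule Liouville_theorem[OF A])
    hence per: "A (z + of_real pi) = A z" for z by (auto simp: constant_on_def)
    \<comment> \<open>Only odd multiples of \<open>z\<close> occur in the exponents of
      \<open>A\<close>, so a constant \<open>A\<close> must be 0.\<close>
    have antiper: "A (z + of_real pi) = - A z" for z
    proof -
      have "exp (\<i> * (z + pi)) = - exp (\<i> * z)" "exp (2 * \<i> * (z + pi)) = exp (2 * \<i> * z)"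
        by (simp_all add: exp_add distrib_left exp_eq_1)
      thus ?thesis by (simp add: A_def)
    qed
    have "A z = 0" for z using per[of z] antiper[of z] by simp
    hence zero: "a (exp (2 * \<i> * z)) = 0" for z by (simp add: A_def)
    \<comment> \<open>At \<open>w = 1\<close> the recursion links exactly these two values, which
      leaves \<open>c = 0\<close>.\<close>
    have "a 1 = 0" "a (exp (2 * \<i> * pi * \<tau>)) = 0"
      using zero[of 0] zero[of "pi * \<tau>"] by (simp_all add: mult.assoc)
    thus False using a(3)[of 1] \<open>c \<noteq> 0\<close> by simp
  qed
  thus ?thesis using that by blast
qed

text \<open>Oddness gives a zero at 0 and the multipliers spread it over the lattice, so
  \<open>theta1\<close> vanishes wherever \<open>P\<close> does. Hence it is a nonzero multiple of
  \<open>P\<close>, which transfers the converse inclusion and simplicity.\<close>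

lemma
  assumes \<tau>: "Im \<tau> > 0"
  shows theta1_eq_0_iff: "theta1 z \<tau> = 0 \<longleftrightarrow> z \<in> period_lattice \<tau>"
    and theta1_zeros_simple: "theta1 z \<tau> = 0 \<Longrightarrow> deriv (\<lambda>z. theta1 z \<tau>) z \<noteq> 0"
proof -
  obtain P where P: "P holomorphic_on UNIV"
    "\<And>z. P (z + of_real pi) = - P z"
    "\<And>z. P (z + of_real pi * \<tau>) = - exp (- \<i> * pi * \<tau> - 2 * \<i> * z) * P z"
    "\<And>z. P z = 0 \<longleftrightarrow> z \<in> period_lattice \<tau>"
    "\<And>z. P z = 0 \<Longrightarrow> deriv P z \<noteq> 0"
    using lattice_function_exists[OF \<tau>] by blast
  have zero: "theta1 z \<tau> = 0" if "z \<in> period_lattice \<tau>" for z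
  proof -
    have "theta1 (0 + z) \<tau> = 0 \<longleftrightarrow> theta1 0 \<tau> = 0"
      by (rule period_lattice_induct[OF that, where P = "\<lambda>z. theta1 z \<tau> = 0"])
        (simp_all add: theta1_add_pi[OF \<tau>] theta1_add_pi_tau[OF \<tau>])
    thus ?thesis using theta1_minus[OF \<tau>, of 0] by simp
  qed
  \<comment> \<open>Both multipliers are packed into one function of the period; \<open>ne\<close>
    makes the case distinction on \<open>p\<close> unambiguous.\<close>
  define t where "t = (\<lambda>(p :: complex) z. if p = of_real pi then -1 else - exp (- \<i> * pi * \<tau> - 2 * \<i> * z))"
  have ne: "of_real pi * \<tau> \<noteq> of_real pi" using \<tau> by (auto simp: complex_eq_iff)
  obtain c where c: "\<And>z. theta1 z \<tau> = c * P z"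
    by (rule same_multipliers_proportional[OF _ theta1_holomorphic[OF \<tau>] P(1), of \<tau> t])
      (use \<tau> ne P zero in \<open>auto simp: t_def theta1_add_pi theta1_add_pi_tau\<close>)
  obtain u where "theta1 u \<tau> \<noteq> 0" by (rule theta1_not_identically_0[OF \<tau>])
  hence "c \<noteq> 0" by (auto simp: c)
  show "theta1 z \<tau> = 0 \<longleftrightarrow> z \<in> period_lattice \<tau>"
    using \<open>c \<noteq> 0\<close> by (simp add: c P(4))
  have "deriv (\<lambda>z. c * P z) z = c * deriv P z"
    using holomorphic_derivI[OF P(1), of z] by (intro DERIV_imp_deriv DERIV_cmult) auto
  thus "theta1 z \<tau> = 0 \<Longrightarrow> deriv (\<lambda>z. theta1 z \<tau>) z \<noteq> 0"
    using \<open>c \<noteq> 0\<close> P(5)[of z] by (auto simp: c)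
qed

section \<open>Partial fractions\<close>

text \<open>Near \<open>z\<close> the function is \<open>g w * (w - z)\<close> with
  \<open>g z \<noteq> 0\<close>, and its derivative at \<open>z\<close> is \<open>g z\<close>. The
  point \<open>w\<close> excludes the zero function, for which this factorization fails.\<close>

lemma simple_zero_deriv_nonzero:
  assumes f: "f holomorphic_on UNIV" and nonconst: "f w \<noteq> 0" and zero: "f z = 0" and ord: "zorder f z = 1"
  shows "deriv f z \<noteq> 0"
proof -
  have "\<exists>w\<in>UNIV. f w \<noteq> 0" using nonconst by blast
  from zorder_exist_zero[OF f open_UNIV connected_UNIV UNIV_I this, of z] zero ord
  obtain r where r: "r > 0" "zor_poly f z holomorphic_on cball z r"
    "\<And>w. w \<in> cball z r \<Longrightarrow> f w = zor_poly f z w * (w - z) \<and> zor_poly f z w \<noteq> 0"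
    by auto
  define g where "g = zor_poly f z"
  have "g holomorphic_on ball z r"
    using r(2) unfolding g_def by (rule holomorphic_on_subset) auto
  hence "(g has_field_derivative deriv g z) (at z)"
    by (rule holomorphic_derivI) (use r(1) in auto)
  hence "((\<lambda>w. g w * (w - z)) has_field_derivative g z) (at z)"
    by (auto intro!: derivative_eq_intros)
  moreover have "eventually (\<lambda>w. w \<in> ball z r) (nhds z)"
    using r(1) by (intro eventually_nhds_in_open) auto
  hence "eventually (\<lambda>w. f w = g w * (w - z)) (nhds z)"
    by eventually_elim (use r(3) in \<open>auto simp: g_def\<close>)
  ultimately have "deriv f z = g z"
    by (metis DERIV_cong_ev DERIV_imp_deriv)
  thus ?thesis using r(3)[of z] r(1) by (simp add: g_def)
qed

lemma countable_period_lattice: "countable (period_lattice \<tau>)"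
proof -
  have "period_lattice \<tau> = range (\<lambda>(m, l). of_int m * of_real pi + of_int l * of_real pi * \<tau>)"
    by (auto simp: period_lattice_def)
  thus ?thesis by simp
qed

text \<open>Finitely many translates of a countable lattice cannot cover the plane.\<close>

lemma complete_inequivalent_zeros_nonzero:
  assumes "complete_inequivalent_zeros \<tau> G A" "finite A"
  obtains z where "G z \<noteq> 0"
proof -
  have "\<exists>z. G z \<noteq> 0"
  proof (rule ccontr)
    assume "\<nexists>z. G z \<noteq> 0"
    hence "\<exists>a\<in>A. z - a \<in> period_lattice \<tau>" for z
      using assms(1) unfolding complete_inequivalent_zeros_def equivalent_def by blast
    hence "UNIV \<subseteq> (\<Union>a\<in>A. (+) a ` period_lattice \<tau>)"
      by (force simp: image_iff algebra_simps)
    moreover have "countable (\<Union>a\<in>A. (+) a ` period_lattice \<tau>)"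
      using assms(2) by (intro countable_UN countable_image countable_period_lattice) (rule countable_finite)
    ultimately have "countable (UNIV :: complex set)"
      by (rule countable_subset)
    thus False using uncountable_UNIV_complex by blast
  qed
  thus ?thesis using that by blast
qed

lemma quasi_periodic_entire_zero:
  assumes \<tau>: "Im \<tau> > 0" and H: "H holomorphic_on UNIV"
    and pi: "\<And>z. H (z + of_real pi) = H z"
    and tau: "\<And>z. H (z + of_real pi * \<tau>) = exp (- (2 * \<i> * y)) * H z"
    and y: "y \<notin> period_lattice \<tau>"
  shows "H z = 0"
proof -
  \<comment> \<open>A real \<beta> keeps the multiplier under \<open>pi\<close> unimodular; this
    value cancels the real part of \<open>\<i> * \<beta> * pi * \<tau> - 2 * \<i> * y\<close>,
    making the other one unimodular too.\<close>
  define \<beta> where "\<beta> = 2 * Im y / (pi * Im \<tau>)"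
  define K where "K = (\<lambda>z. exp (\<i> * of_real \<beta> * z) * H z)"
  have K_pi: "K (z + of_real pi) = exp (\<i> * of_real \<beta> * of_real pi) * K z" for z
    by (simp add: K_def pi exp_add distrib_left)
  have K_tau: "K (z + of_real pi * \<tau>) = exp (\<i> * of_real \<beta> * of_real pi * \<tau> - 2 * \<i> * y) * K z" for z
    unfolding K_def tau by (simp add: exp_add exp_diff exp_minus distrib_left divide_inverse mult_ac)
  obtain c where c: "\<And>z. K z = c"
  proof (rule doubly_periodic_constant[of \<tau> K])
    show "K holomorphic_on UNIV" unfolding K_def by (intro holomorphic_intros H)
    show "norm (K (z + of_real pi)) = norm (K z)" for z
      by (simp add: K_pi norm_mult)
    show "norm (K (z + of_real pi * \<tau>)) = norm (K z)" for z
      using \<tau> by (simp add: K_tau norm_mult \<beta>_def)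
  qed (use \<tau> in auto)
  \<comment> \<open>A nonzero constant \<open>K\<close> forces both multipliers to be 1. The first
    then gives \<open>\<beta> = 2 * k\<close>, and the second exhibits \<open>y\<close> as a
    period.\<close>
  have "c = 0"
  proof (rule ccontr)
    assume "c \<noteq> 0"
    have "exp (\<i> * of_real \<beta> * of_real pi) = 1" "exp (\<i> * of_real \<beta> * of_real pi * \<tau> - 2 * \<i> * y) = 1"
      using K_pi[of 0] K_tau[of 0] \<open>c \<noteq> 0\<close> unfolding c by simp_all
    then obtain k j :: int where k: "Im (\<i> * of_real \<beta> * of_real pi) = of_int (2 * k) * pi"
      and j: "Re (\<i> * of_real \<beta> * of_real pi * \<tau> - 2 * \<i> * y) = 0"
        "Im (\<i> * of_real \<beta> * of_real pi * \<tau> - 2 * \<i> * y) = of_int (2 * j) * pi"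
      unfolding exp_eq_1 by blast
    from k have "\<beta> = 2 * of_int k" by simp
    with j have "y = of_int (- j) * of_real pi + of_int k * of_real pi * \<tau>"
      by (simp add: complex_eq_iff algebra_simps)
    thus False using y unfolding period_lattice_def by blast
  qed
  thus ?thesis using c[of z] by (simp add: K_def)
qed

text \<open>The derivative is doubly periodic, hence constant, so \<open>H\<close> is affine.
  Periodicity under \<open>pi\<close> makes the slope 0, and with it the increment.\<close>

lemma additive_entire_increment_zero:
  assumes \<tau>: "Im \<tau> \<noteq> 0" and H: "H holomorphic_on UNIV"
    and pi: "\<And>z. H (z + of_real pi) = H z"
    and tau: "\<And>z. H (z + of_real pi * \<tau>) = H z + s"
  shows "s = 0"
proof -
  have H': "(H has_field_derivative deriv H z) (at z)" for z
    by (rule holomorphic_derivI[OF H]) auto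
  have deriv_shift: "deriv H (z + p) = deriv H z" if "\<And>z. H (z + p) = H z + u" for z p u
  proof -
    have "((\<lambda>z. H (z + p)) has_field_derivative deriv H (z + p)) (at z)"
      using H'[of "z + p"] unfolding DERIV_shift .
    moreover have "((\<lambda>z. H z + u) has_field_derivative deriv H z) (at z)"
      using DERIV_add[OF H'[of z] DERIV_const[of u]] by simp
    ultimately show ?thesis unfolding that by (rule DERIV_unique)
  qed
  obtain A where A: "\<And>z. deriv H z = A"
  proof (rule doubly_periodic_constant[of \<tau> "deriv H"])
    show "deriv H holomorphic_on UNIV" by (intro holomorphic_deriv H open_UNIV)
    show "norm (deriv H (z + of_real pi)) = norm (deriv H z)" for z
      using deriv_shift[of "of_real pi" 0] pi by simp
    show "norm (deriv H (z + of_real pi * \<tau>)) = norm (deriv H z)" for z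
      using deriv_shift[of "of_real pi * \<tau>" s] tau by simp
  qed (use \<tau> in auto)
  have "((\<lambda>z. H z - A * z) has_field_derivative 0) (at z within UNIV)" for z
    using H'[of z] by (auto intro!: derivative_eq_intros simp: A)
  then obtain B where "\<And>z. H z - A * z = B"
    using has_field_derivative_zero_constant[OF convex_UNIV, of "\<lambda>z. H z - A * z"] by blast
  hence eq: "H z = A * z + B" for z by (simp add: diff_eq_eq add.commute)
  have "A = 0" using pi[of 0] by (simp add: eq)
  thus "s = 0" using tau[of 0] by (simp add: eq)
qed

text \<open>The kernel \<open>\<phi> / \<theta>\<^sub>1\<close> has residue 1 at the origin. It is used for \<open>\<phi>(z) = \<theta>\<^sub>1(z + y) \<theta>\<^sub>1'(0) / \<theta>\<^sub>1(y)\<close>,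
  where the increments \<open>s\<close> vanish, and for \<open>\<phi> = \<theta>\<^sub>1'\<close>, where the multipliers \<open>c\<close> are 1.\<close>

lemma theta1_partial_fraction:
  fixes c s :: "complex \<Rightarrow> complex" and m t :: "complex \<Rightarrow> complex \<Rightarrow> complex"
  assumes \<tau>: "Im \<tau> > 0"
    and F: "F holomorphic_on UNIV" and G: "G holomorphic_on UNIV" and \<phi>: "\<phi> holomorphic_on UNIV"
    and simple: "\<And>z. G z = 0 \<Longrightarrow> deriv G z \<noteq> 0"
    and inj: "inj_on a {1..n :: nat}"
    and zeros: "complete_inequivalent_zeros \<tau> G (a ` {1..n})"
    and \<phi>_0: "\<phi> 0 = deriv (\<lambda>w. theta1 w \<tau>) 0"
    and shift: "\<And>p z. p \<in> {of_real pi, of_real pi * \<tau>} \<Longrightarrow> G (z + p) = m p z * G z"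
      "\<And>p z. p \<in> {of_real pi, of_real pi * \<tau>} \<Longrightarrow> F (z + p) = c p * m p z * F z"
      "\<And>p z. p \<in> {of_real pi, of_real pi * \<tau>} \<Longrightarrow> theta1 (z + p) \<tau> = t p z * theta1 z \<tau>"
      "\<And>p z. p \<in> {of_real pi, of_real pi * \<tau>} \<Longrightarrow> \<phi> (z + p) = t p z * (c p * \<phi> z + s p * theta1 z \<tau>)"
    and nz: "\<And>p z. p \<in> {of_real pi, of_real pi * \<tau>} \<Longrightarrow> c p \<noteq> 0 \<and> m p z \<noteq> 0 \<and> t p z \<noteq> 0"
    and m: "\<And>p. p \<in> {of_real pi, of_real pi * \<tau>} \<Longrightarrow> continuous_on UNIV (m p)"
  obtains H where "H holomorphic_on UNIV"
    "\<And>z. G z \<noteq> 0 \<Longrightarrow> F z / G z = H z + (\<Sum>k=1..n. F (a k) / deriv G (a k) * (\<phi> (z - a k) / theta1 (z - a k) \<tau>))"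
    "\<And>p z. p \<in> {of_real pi, of_real pi * \<tau>} \<Longrightarrow> H (z + p) = c p * H z - s p * (\<Sum>k=1..n. F (a k) / deriv G (a k))"
proof -
  define th where "th = (\<lambda>z. theta1 z \<tau>)"
  define r where "r = (\<lambda>k. F (a k) / deriv G (a k))"
  define R where "R = (\<Sum>k=1..n. r k)"
  have th: "th holomorphic_on UNIV" unfolding th_def by (rule theta1_holomorphic[OF \<tau>])
  have th_0: "th z = 0 \<longleftrightarrow> z \<in> period_lattice \<tau>" for z
    unfolding th_def by (rule theta1_eq_0_iff[OF \<tau>])
  have th_simple: "th z = 0 \<Longrightarrow> deriv th z \<noteq> 0" for z
    unfolding th_def by (rule theta1_zeros_simple[OF \<tau>])
  have th_deriv: "((\<lambda>z. th (z - b)) has_field_derivative deriv th (z - b)) (at z)" for b z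
  proof -
    have "(th has_field_derivative deriv th (z + - b)) (at (z + - b))"
      by (rule holomorphic_derivI[OF th]) auto
    thus ?thesis unfolding DERIV_shift by simp
  qed
  have shift_hol: "(\<lambda>z. f (z - b)) holomorphic_on UNIV" if "f holomorphic_on UNIV" for f :: "complex \<Rightarrow> complex" and b
    by (rule holomorphic_on_compose_gen[OF _ that, unfolded o_def]) (auto intro!: holomorphic_intros)
  have G_zero: "G z = 0" if "th (z - a k) = 0" "k \<in> {1..n}" for z k
  proof -
    have "G (a k) = 0" using zeros that(2) by (auto simp: complete_inequivalent_zeros_def)
    moreover have "G (a k + (z - a k)) = 0 \<longleftrightarrow> G (a k) = 0"
    proof (rule period_lattice_induct[where P = "\<lambda>z. G z = 0" and \<tau> = \<tau>])
      show "z - a k \<in> period_lattice \<tau>" using that(1) th_0 by simp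
    qed (use shift(1) nz in auto)
    ultimately show ?thesis by simp
  qed
  have "\<exists>h. h holomorphic_on UNIV \<and> (\<forall>z. G z = h z * th (z - a k))" if "k \<in> {1..n}" for k
  proof -
    have "deriv (\<lambda>z. th (z - a k)) z \<noteq> 0" if "th (z - a k) = 0" for z
      using DERIV_imp_deriv[OF th_deriv[of "a k" z]] th_simple[OF that] by simp
    from entire_quotient[OF G shift_hol[OF th] this G_zero[OF _ that]] show ?thesis by metis
  qed
  then obtain g where g: "\<And>k. k \<in> {1..n} \<Longrightarrow> g k holomorphic_on UNIV"
    and g_eq: "\<And>k z. k \<in> {1..n} \<Longrightarrow> G z = g k z * th (z - a k)" by metis
  \<comment> \<open>\<open>D\<close> is \<open>G\<close> times the difference of
    \<open>F / G\<close> and the proposed sum. Writing \<open>G\<close> as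
    \<open>g k z * th (z - a k)\<close> clears each denominator, so \<open>D\<close> is entire; it
    remains to divide it by \<open>G\<close>.\<close>
  define D where "D = (\<lambda>z. F z - (\<Sum>k=1..n. r k * (g k z * \<phi> (z - a k))))"
  have D: "D holomorphic_on UNIV" unfolding D_def
    by (intro holomorphic_intros F g shift_hol[OF \<phi>])
  have D_eq: "D z = G z * (F z / G z - (\<Sum>k=1..n. r k * (\<phi> (z - a k) / th (z - a k))))" if "G z \<noteq> 0" for z
  proof -
    have "r k * (g k z * \<phi> (z - a k)) = G z * (r k * (\<phi> (z - a k) / th (z - a k)))" if "k \<in> {1..n}" for k
    proof -
      have "th (z - a k) \<noteq> 0" using G_zero[OF _ that] \<open>G z \<noteq> 0\<close> by blast
      thus ?thesis using g_eq[OF that, of z] by simp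
    qed
    hence "(\<Sum>k=1..n. r k * (g k z * \<phi> (z - a k))) = G z * (\<Sum>k=1..n. r k * (\<phi> (z - a k) / th (z - a k)))"
      unfolding sum_distrib_left by (rule sum.cong[OF refl])
    thus ?thesis using that by (simp add: D_def right_diff_distrib)
  qed
  have D_shift: "D (z + p) = m p z * (c p * D z - s p * R * G z)"
    if p: "p \<in> {of_real pi, of_real pi * \<tau>}" for p z
  proof -
    define d where "d = (\<lambda>z. D (z + p) - m p z * (c p * D z - s p * R * G z))"
    have "d z = 0"
    proof (rule simple_zeros_dense[OF _ simple, where h = d])
      have cont: "continuous_on UNIV D" "continuous_on UNIV G"
        using D G by (auto intro: holomorphic_on_imp_continuous_on)
      show "continuous_on UNIV d" unfolding d_def
        by (intro continuous_intros continuous_on_compose2[OF cont(1)] cont m[OF p]) auto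
      show "d z = 0" if "G z \<noteq> 0" for z
      proof -
        have Gp: "G (z + p) \<noteq> 0" using shift(1)[OF p, of z] nz[OF p, of z] that by simp
        have "\<phi> (z + p - a k) / th (z + p - a k) = c p * (\<phi> (z - a k) / th (z - a k)) + s p" if k: "k \<in> {1..n}" for k
        proof -
          have "th (z - a k) \<noteq> 0" using G_zero[OF _ k] \<open>G z \<noteq> 0\<close> by blast
          moreover have "\<phi> (z - a k + p) / th (z - a k + p) = (c p * \<phi> (z - a k) + s p * th (z - a k)) / th (z - a k)"
            unfolding shift(4)[OF p] unfolding th_def shift(3)[OF p] using nz[OF p, of "z - a k"] by simp
          ultimately show ?thesis by (simp add: add_divide_distrib diff_add_eq)
        qed
        hence "(\<Sum>k=1..n. r k * (\<phi> (z + p - a k) / th (z + p - a k))) =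
               (\<Sum>k=1..n. r k * (c p * (\<phi> (z - a k) / th (z - a k)) + s p))"
          by (intro sum.cong[OF refl]) simp
        also have "\<dots> = c p * (\<Sum>k=1..n. r k * (\<phi> (z - a k) / th (z - a k))) + s p * R"
          unfolding R_def sum_distrib_left sum.distrib[symmetric] by (intro sum.cong[OF refl]) (simp add: algebra_simps)
        finally have sum_eq: "(\<Sum>k=1..n. r k * (\<phi> (z + p - a k) / th (z + p - a k))) = \<dots>" .
        have FG: "F (z + p) / G (z + p) = c p * (F z / G z)"
          unfolding shift(1)[OF p] shift(2)[OF p] using nz[OF p, of z] by simp
        show ?thesis
          unfolding d_def D_eq[OF that] D_eq[OF Gp] FG sum_eq unfolding shift(1)[OF p] by (simp add: algebra_simps)
      qed
    qed
    thus ?thesis by (simp add: d_def)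
  qed
  \<comment> \<open>This is the matching of residues. Inequivalence kills all terms except the one
    with index \<open>j\<close>, and \<open>deriv G (a j) = deriv th 0 * g j (a j)\<close> turns
    that one into \<open>F (a j)\<close>.\<close>
  have D_a: "D (a j) = 0" if j: "j \<in> {1..n}" for j
  proof -
    have Gj: "G (a j) = 0" using zeros j by (simp add: complete_inequivalent_zeros_def)
    have g_zero: "g k (a j) = 0" if k: "k \<in> {1..n}" "k \<noteq> j" for k
    proof -
      have "a j \<noteq> a k" using inj_on_eq_iff[OF inj j k(1)] k(2) by blast
      hence "th (a j - a k) \<noteq> 0"
        using zeros k(1) j unfolding th_0 complete_inequivalent_zeros_def equivalent_def by (meson imageI)
      thus ?thesis using g_eq[OF k(1), of "a j"] Gj by simp
    qed
    have th0: "th 0 = 0" unfolding th_def using theta1_minus[OF \<tau>, of 0] by simp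
    have "((\<lambda>z. g j z * th (z - a j)) has_field_derivative (deriv (g j) (a j) * th (a j - a j) + deriv th (a j - a j) * g j (a j))) (at (a j))"
      by (rule DERIV_mult[OF holomorphic_derivI[OF g[OF j]] th_deriv]) auto
    hence dG: "deriv G (a j) = deriv th 0 * g j (a j)"
      using th0 unfolding g_eq[OF j, symmetric] by (simp add: DERIV_imp_deriv)
    have "(\<Sum>k=1..n. r k * (g k (a j) * \<phi> (a j - a k))) = r j * (g j (a j) * \<phi> 0)"
      using j g_zero by (subst sum.remove[OF _ j]) (auto intro!: sum.neutral)
    also have "\<dots> = F (a j)"
      using simple[OF Gj] dG by (simp add: r_def \<phi>_0 th_def[symmetric])
    finally show ?thesis by (simp add: D_def)
  qed
  have D_zero: "D z = 0" if Gz: "G z = 0" for z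
  proof -
    obtain j where j: "j \<in> {1..n}" "z - a j \<in> period_lattice \<tau>"
      using zeros Gz unfolding complete_inequivalent_zeros_def equivalent_def by blast
    \<comment> \<open>The invariant is an implication because the shift of \<open>D\<close> contains
      a multiple of \<open>G z\<close>, which disappears only at zeros of \<open>G\<close>.\<close>
    have "(G (a j + (z - a j)) = 0 \<longrightarrow> D (a j + (z - a j)) = 0) \<longleftrightarrow> (G (a j) = 0 \<longrightarrow> D (a j) = 0)"
    proof (rule period_lattice_induct[OF j(2), where P = "\<lambda>z. G z = 0 \<longrightarrow> D z = 0"])
      have "(G (z + p) = 0 \<longrightarrow> D (z + p) = 0) \<longleftrightarrow> (G z = 0 \<longrightarrow> D z = 0)" if "p \<in> {of_real pi, of_real pi * \<tau>}" for p z
        using shift(1)[OF that, of z] nz[OF that, of z] D_shift[OF that, of z] by auto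
      thus "(G (z + pi) = 0 \<longrightarrow> D (z + pi) = 0) \<longleftrightarrow> (G z = 0 \<longrightarrow> D z = 0)"
        "(G (z + pi * \<tau>) = 0 \<longrightarrow> D (z + pi * \<tau>) = 0) \<longleftrightarrow> (G z = 0 \<longrightarrow> D z = 0)" for z :: complex by simp_all
    qed
    thus ?thesis using D_a[OF j(1)] Gz by simp
  qed
  obtain H where H: "H holomorphic_on UNIV" "\<And>z. D z = H z * G z"
    using entire_quotient[OF D G simple D_zero] by blast
  show ?thesis
  proof (rule that[OF H(1)])
    fix z assume "G z \<noteq> 0"
    thus "F z / G z = H z + (\<Sum>k=1..n. F (a k) / deriv G (a k) * (\<phi> (z - a k) / theta1 (z - a k) \<tau>))"
      using D_eq[of z] H(2)[of z] by (simp add: r_def th_def)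
  next
    fix p z assume p: "p \<in> {of_real pi, of_real pi * \<tau>}"
    define d where "d = (\<lambda>z. H (z + p) - (c p * H z - s p * R))"
    have "d z = 0"
    proof (rule simple_zeros_dense[OF _ simple, where h = d])
      have cont: "continuous_on UNIV H"
        using H(1) by (rule holomorphic_on_imp_continuous_on)
      show "continuous_on UNIV d" unfolding d_def
        by (intro continuous_intros continuous_on_compose2[OF cont] cont) auto
      show "d z = 0" if "G z \<noteq> 0" for z
      proof -
        have "m p z * G z * H (z + p) = m p z * G z * (c p * H z - s p * R)"
          using D_shift[OF p, of z] shift(1)[OF p, of z] H(2)[of z] H(2)[of "z + p"] by (simp add: algebra_simps)
        thus ?thesis using nz[OF p, of z] that by (simp add: d_def)
      qed
    qed
    thus "H (z + p) = c p * H z - s p * (\<Sum>k=1..n. F (a k) / deriv G (a k))"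
      by (simp add: d_def R_def r_def)
  qed
qed

text \<open>After multiplication by \<open>exp (2 * \<i> * l * u)\<close> the translate has the
  multipliers of \<open>theta1\<close> itself, so the two are proportional. The value of
  \<open>\<kappa>\<close> is left open, since it will multiply a sum equal to 0.\<close>

lemma theta1_add_period:
  assumes \<tau>: "Im \<tau> > 0"
  obtains \<kappa> where "\<And>u. theta1 (u + (of_int j * of_real pi + of_int l * of_real pi * \<tau>)) \<tau> = \<kappa> * exp (- (2 * \<i> * of_int l * u)) * theta1 u \<tau>"
proof -
  define y where "y = of_int j * of_real pi + of_int l * of_real pi * \<tau>"
  define t where "t = (\<lambda>(p :: complex) z. if p = of_real pi then -1 else - exp (- \<i> * pi * \<tau> - 2 * \<i> * z))"
  have ne: "of_real pi * \<tau> \<noteq> of_real pi" using \<tau> by (auto simp: complex_eq_iff)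
  define f where "f = (\<lambda>u. theta1 (u + y) \<tau> * exp (2 * \<i> * of_int l * u))"
  obtain \<kappa> where \<kappa>: "\<And>u. f u = \<kappa> * theta1 u \<tau>"
  proof (rule same_multipliers_proportional[OF _ _ theta1_holomorphic[OF \<tau>], where f = f and t = t])
    have "(\<lambda>u. theta1 (u + y) \<tau>) holomorphic_on UNIV"
      by (rule holomorphic_on_compose_gen[OF _ theta1_holomorphic[OF \<tau>], unfolded o_def]) (auto intro!: holomorphic_intros)
    thus "f holomorphic_on UNIV" unfolding f_def by (intro holomorphic_intros)
    fix z assume z: "theta1 z \<tau> = 0"
    have "theta1 (z + y) \<tau> = 0 \<longleftrightarrow> theta1 z \<tau> = 0"
    proof (rule period_lattice_induct[where P = "\<lambda>z. theta1 z \<tau> = 0" and \<tau> = \<tau>])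
      show "y \<in> period_lattice \<tau>" unfolding y_def period_lattice_def by blast
    qed (simp_all add: theta1_add_pi[OF \<tau>] theta1_add_pi_tau[OF \<tau>])
    thus "f z = 0" using z by (simp add: f_def)
    show "deriv (\<lambda>z. theta1 z \<tau>) z \<noteq> 0" by (rule theta1_zeros_simple[OF \<tau> z])
  next
    fix p z assume p: "p \<in> {of_real pi, of_real pi * \<tau>}"
    show "theta1 (z + p) \<tau> = t p z * theta1 z \<tau>" "t p z \<noteq> 0"
      using p ne theta1_add_pi[OF \<tau>] theta1_add_pi_tau[OF \<tau>] by (auto simp: t_def)
    have f_pi: "f (z + of_real pi) = - f z"
    proof -
      have "exp (2 * \<i> * of_int l * of_real pi) = 1" by (simp add: exp_eq_1)
      moreover have "theta1 (z + of_real pi + y) \<tau> = - theta1 (z + y) \<tau>"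
        using theta1_add_pi[OF \<tau>, of "z + y"] by (simp add: add_ac)
      ultimately show ?thesis by (simp add: f_def distrib_left exp_add)
    qed
    have f_tau: "f (z + of_real pi * \<tau>) = - exp (- \<i> * pi * \<tau> - 2 * \<i> * z) * f z"
    proof -
      \<comment> \<open>The \<open>l\<close> part of \<open>- 2 * \<i> * y\<close> cancels against
        the shift of the second exponential, leaving only a multiple of
        \<open>2 * pi * \<i>\<close>.\<close>
      have "exp (- \<i> * pi * \<tau> - 2 * \<i> * (z + y)) * exp (2 * \<i> * of_int l * (z + of_real pi * \<tau>)) =
          exp (- \<i> * pi * \<tau> - 2 * \<i> * z + 2 * \<i> * of_int l * z + of_int (- j) * (2 * of_real pi * \<i>))"
        by (simp add: y_def algebra_simps flip: exp_add)
      also have "\<dots> = exp (- \<i> * pi * \<tau> - 2 * \<i> * z) * exp (2 * \<i> * of_int l * z)"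
      proof -
        have "exp (of_int (- j) * (2 * of_real pi * \<i>)) = 1"
          using exp_integer_2pi[of "of_int (- j)"] by (simp add: mult_ac)
        thus ?thesis unfolding exp_add by simp
      qed
      finally have *: "exp (- \<i> * pi * \<tau> - 2 * \<i> * (z + y)) * exp (2 * \<i> * of_int l * (z + of_real pi * \<tau>)) = \<dots>" .
      have "theta1 (z + of_real pi * \<tau> + y) \<tau> = - exp (- \<i> * pi * \<tau> - 2 * \<i> * (z + y)) * theta1 (z + y) \<tau>"
        using theta1_add_pi_tau[OF \<tau>, of "z + y"] by (simp add: add_ac)
      hence "f (z + of_real pi * \<tau>) = - (exp (- \<i> * pi * \<tau> - 2 * \<i> * (z + y)) * exp (2 * \<i> * of_int l * (z + of_real pi * \<tau>))) * theta1 (z + y) \<tau>"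
        by (simp add: f_def)
      thus ?thesis unfolding * by (simp add: f_def)
    qed
    show "f (z + p) = t p z * f z"
      using p ne f_pi f_tau by (auto simp: t_def)
  qed (use \<tau> in auto)
  have "theta1 (u + y) \<tau> = \<kappa> * exp (- (2 * \<i> * of_int l * u)) * theta1 u \<tau>" for u
    using \<kappa>[of u] by (simp add: f_def exp_minus field_simps)
  thus ?thesis using that unfolding y_def by blast
qed

section \<open>The identity, according to whether \<open>theta1 y \<tau>\<close> vanishes\<close>

theorem theorem1p9:
  fixes \<tau> y \<epsilon> :: complex and n :: nat and F G :: "complex \<Rightarrow> complex" and a :: "nat \<Rightarrow> complex"
  assumes "Im \<tau> > 0"
    and "n > 0"
    and "\<epsilon> \<in> {1, -1}"
    and "F holomorphic_on UNIV"
    and "G holomorphic_on UNIV"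
    and "\<not> (\<exists>z. F z = 0 \<and> G z = 0)"
    and "\<And>z. F z = (-1) ^ n * F (z + of_real pi)"
    and "\<And>z. F z = \<epsilon> * qpow \<tau> (of_nat n / 2) * exp (2 * \<i> * of_nat n * z + 2 * \<i> * y) * F (z + of_real pi * \<tau>)"
    and "\<And>z. G z = (-1) ^ n * G (z + of_real pi)"
    and "\<And>z. G z = \<epsilon> * qpow \<tau> (of_nat n / 2) * exp (2 * \<i> * of_nat n * z) * G (z + of_real pi * \<tau>)"
    and "\<And>z. G z = 0 \<Longrightarrow> zorder G z = 1"
    and "inj_on a {1..n}"
    and "complete_inequivalent_zeros \<tau> G (a ` {1..n})"
  shows "\<forall>z. G z \<noteq> 0 \<longrightarrow>
    F z * theta1 y \<tau> / (deriv (\<lambda>w. theta1 w \<tau>) 0 * G z) =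
    (\<Sum>k=1..n. F (a k) * theta1 (z + y - a k) \<tau> / (deriv G (a k) * theta1 (z - a k) \<tau>))"
proof (intro allI impI)
  fix z assume Gz: "G z \<noteq> 0"
  note \<tau> = assms(1) and F = assms(4) and G = assms(5)
  define \<theta> where "\<theta> = (\<lambda>w. theta1 w \<tau>)"
  have \<theta>: "\<theta> holomorphic_on UNIV"
    unfolding \<theta>_def by (rule theta1_holomorphic[OF \<tau>])
  have \<theta>_pi: "\<theta> (u + of_real pi) = - \<theta> u"
    and \<theta>_tau: "\<theta> (u + of_real pi * \<tau>) = - exp (- \<i> * pi * \<tau> - 2 * \<i> * u) * \<theta> u" for u
    unfolding \<theta>_def by (rule theta1_add_pi[OF \<tau>], rule theta1_add_pi_tau[OF \<tau>])
  have "\<theta> 0 = 0" unfolding \<theta>_def using theta1_minus[OF \<tau>, of 0] by simp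
  hence \<theta>'_0: "deriv \<theta> 0 \<noteq> 0"
    unfolding \<theta>_def by (rule theta1_zeros_simple[OF \<tau>])
  have simple: "deriv G u \<noteq> 0" if "G u = 0" for u
    by (rule simple_zero_deriv_nonzero[OF G Gz that assms(11)[OF that]])
  have ne: "of_real pi * \<tau> \<noteq> of_real pi" using \<tau> by (auto simp: complex_eq_iff)
  define t where "t = (\<lambda>(p :: complex) u. if p = of_real pi then -1 else - exp (- \<i> * pi * \<tau> - 2 * \<i> * u))"
  have t: "\<theta> (u + p) = t p u * \<theta> u \<and> t p u \<noteq> 0" if "p \<in> {of_real pi, of_real pi * \<tau>}" for p u
    using that ne \<theta>_pi \<theta>_tau by (auto simp: t_def)
  \<comment> \<open>The hypothesis on \<open>G\<close> reads
    \<open>G u = \<mu> u * G (u + pi * \<tau>)\<close>, so the multiplier of \<open>G\<close> in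
    \<open>m\<close> is the inverse of \<open>\<mu>\<close>. The constant \<open>e\<close> below is
    the multiplier of \<open>F / G\<close>.\<close>
  define \<mu> where "\<mu> = (\<lambda>u. \<epsilon> * qpow \<tau> (of_nat n / 2) * exp (2 * \<i> * of_nat n * u))"
  have \<mu>: "\<mu> u \<noteq> 0" for u
    using assms(3) by (auto simp: \<mu>_def qpow_def)
  define m where "m = (\<lambda>(p :: complex) u. if p = of_real pi then (-1) ^ n else inverse (\<mu> u))"
  have m_cont: "continuous_on UNIV (m p)" for p
  proof -
    have "continuous_on UNIV \<mu>" unfolding \<mu>_def by (intro continuous_intros)
    thus ?thesis using \<mu> by (cases "p = of_real pi") (auto simp: m_def intro!: continuous_intros)
  qed
  have m: "G (u + p) = m p u * G u \<and> m p u \<noteq> 0" if "p \<in> {of_real pi, of_real pi * \<tau>}" for p u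
  proof -
    have "G (u + of_real pi) = (-1) ^ n * G u" using assms(9)[of u] by simp
    moreover have "G (u + of_real pi * \<tau>) = inverse (\<mu> u) * G u"
    proof -
      have "G u = \<mu> u * G (u + of_real pi * \<tau>)"
        unfolding \<mu>_def by (rule assms(10))
      thus ?thesis using \<mu>[of u] by simp
    qed
    ultimately show ?thesis using that ne \<mu>[of u] by (auto simp: m_def)
  qed
  define e where "e = exp (- (2 * \<i> * y))"
  have F_pi: "F (u + of_real pi) = (-1) ^ n * F u" for u
    using assms(7)[of u] by simp
  have F_tau: "F (u + of_real pi * \<tau>) = e * (inverse (\<mu> u) * F u)" for u
  proof -
    have "F u = \<mu> u * (inverse e * F (u + of_real pi * \<tau>))"
      using assms(8)[of u] unfolding exp_add \<mu>_def e_def exp_minus by (simp only: mult.assoc inverse_inverse_eq)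
    moreover have "e \<noteq> 0" by (simp add: e_def)
    ultimately show ?thesis using \<mu>[of u] by (simp add: field_simps)
  qed
  show "F z * theta1 y \<tau> / (deriv (\<lambda>w. theta1 w \<tau>) 0 * G z) =
    (\<Sum>k=1..n. F (a k) * theta1 (z + y - a k) \<tau> / (deriv G (a k) * theta1 (z - a k) \<tau>))"
  proof (cases "\<theta> y = 0")
    case False
    define \<phi> where "\<phi> = (\<lambda>u. \<theta> (u + y) * (deriv \<theta> 0 / \<theta> y))"
    define c where "c = (\<lambda>p :: complex. if p = of_real pi then 1 else e)"
    have "(\<lambda>u. \<theta> (u + y)) holomorphic_on UNIV"
      by (rule holomorphic_on_compose_gen[OF _ \<theta>, unfolded o_def]) (auto intro!: holomorphic_intros)
    hence \<phi>: "\<phi> holomorphic_on UNIV" unfolding \<phi>_def by (intro holomorphic_intros)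
    have \<phi>_shift: "\<phi> (u + p) = t p u * (c p * \<phi> u + 0 * \<theta> u)" if p: "p \<in> {of_real pi, of_real pi * \<tau>}" for p u
    proof -
      have "t p (u + y) = t p u * c p"
        by (simp add: t_def c_def e_def distrib_left exp_diff exp_add exp_minus field_simps)
      moreover have "\<theta> (u + p + y) = t p (u + y) * \<theta> (u + y)"
        using t[OF p, of "u + y"] by (simp add: add_ac)
      ultimately show ?thesis by (simp add: \<phi>_def)
    qed
    obtain H where H: "H holomorphic_on UNIV"
      "\<And>z. G z \<noteq> 0 \<Longrightarrow> F z / G z = H z + (\<Sum>k=1..n. F (a k) / deriv G (a k) * (\<phi> (z - a k) / theta1 (z - a k) \<tau>))"
      "\<And>p z. p \<in> {of_real pi, of_real pi * \<tau>} \<Longrightarrow> H (z + p) = c p * H z - 0 * (\<Sum>k=1..n. F (a k) / deriv G (a k))"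
    proof (rule theta1_partial_fraction[OF \<tau> F G \<phi> simple assms(12,13), of m c t "\<lambda>_. 0"])
      show "\<phi> 0 = deriv (\<lambda>w. theta1 w \<tau>) 0" using False by (simp add: \<phi>_def \<theta>_def)
      fix p u assume p: "p \<in> {of_real pi, of_real pi * \<tau>}"
      show "F (u + p) = c p * m p u * F u"
        using p ne F_pi F_tau by (auto simp: c_def m_def)
      show "G (u + p) = m p u * G u" "theta1 (u + p) \<tau> = t p u * theta1 u \<tau>"
        "c p \<noteq> 0 \<and> m p u \<noteq> 0 \<and> t p u \<noteq> 0"
        using m[OF p, of u] t[OF p, of u] by (auto simp: \<theta>_def c_def e_def)
      show "\<phi> (u + p) = t p u * (c p * \<phi> u + 0 * theta1 u \<tau>)"
        using \<phi>_shift[OF p, of u] by (simp add: \<theta>_def)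
    qed (use m_cont in auto)
    have "H u = 0" for u
    proof (rule quasi_periodic_entire_zero[OF \<tau> H(1)])
      show "y \<notin> period_lattice \<tau>"
        using False theta1_eq_0_iff[OF \<tau>] by (simp add: \<theta>_def)
    qed (use ne H(3) in \<open>auto simp: c_def e_def\<close>)
    hence eq: "F z / G z = (\<Sum>k=1..n. F (a k) / deriv G (a k) * (\<phi> (z - a k) / theta1 (z - a k) \<tau>))"
      using H(2)[OF Gz] by simp
    have "F z * theta1 y \<tau> / (deriv (\<lambda>w. theta1 w \<tau>) 0 * G z) = F z / G z * (\<theta> y / deriv \<theta> 0)"
      by (simp add: \<theta>_def)
    also have "\<dots> = (\<Sum>k=1..n. F (a k) * theta1 (z + y - a k) \<tau> / (deriv G (a k) * theta1 (z - a k) \<tau>))"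
      unfolding eq sum_distrib_right
      using False \<theta>'_0 by (intro sum.cong[OF refl]) (simp add: \<phi>_def \<theta>_def add_diff_eq diff_add_eq)
    finally show ?thesis .
  next
    case True
    hence "y \<in> period_lattice \<tau>" using theta1_eq_0_iff[OF \<tau>] by (simp add: \<theta>_def)
    then obtain j l :: int where y: "y = of_int j * of_real pi + of_int l * of_real pi * \<tau>"
      by (auto simp: period_lattice_def)
    \<comment> \<open>The left-hand side is 0 in this case. The exponential cancels the multiplier
      \<open>e\<close>, which makes \<open>F2 / G\<close> elliptic with residue sum
      \<open>S\<close>.\<close>
    define F2 where "F2 = (\<lambda>u. F u * exp (2 * \<i> * of_int l * u))"
    \<comment> \<open>Logarithmic differentiation of the multipliers shows that
      \<open>deriv \<theta> / \<theta>\<close> is unchanged under \<open>pi\<close> and gains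
      \<open>- 2 * \<i>\<close> under \<open>pi * \<tau>\<close>.\<close>
    define s where "s = (\<lambda>p :: complex. if p = of_real pi then 0 else - (2 * \<i>))"
    define S where "S = (\<Sum>k=1..n. F2 (a k) / deriv G (a k))"
    have F2: "F2 holomorphic_on UNIV" unfolding F2_def by (intro holomorphic_intros F)
    have \<phi>: "deriv \<theta> holomorphic_on UNIV" by (intro holomorphic_deriv \<theta> open_UNIV)
    have exp_l: "exp (2 * \<i> * of_int l * of_real pi) = 1" by (simp add: exp_eq_1)
    have exp_y: "e * exp (2 * \<i> * of_int l * (of_real pi * \<tau>)) = 1"
    proof -
      have "e * exp (2 * \<i> * of_int l * (of_real pi * \<tau>)) = exp (of_int (- j) * (2 * of_real pi * \<i>))"
        unfolding e_def exp_add[symmetric] by (rule arg_cong[of _ _ exp]) (simp add: y algebra_simps)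
      also have "\<dots> = 1"
        using exp_integer_2pi[of "of_int (- j)"] by (simp add: mult_ac)
      finally show ?thesis .
    qed
    have \<theta>_deriv: "(\<theta> has_field_derivative deriv \<theta> u) (at u)" for u
      by (rule holomorphic_derivI[OF \<theta>]) auto
    have deriv_shift: "((\<lambda>u. \<theta> (u + p)) has_field_derivative deriv \<theta> (u + p)) (at u)" for u p
      using \<theta>_deriv[of "u + p"] unfolding DERIV_shift .
    have deriv_pi: "deriv \<theta> (u + of_real pi) = - deriv \<theta> u" for u
      using deriv_shift[of "of_real pi" u] DERIV_minus[OF \<theta>_deriv[of u]]
      unfolding \<theta>_pi by (rule DERIV_unique)
    have deriv_tau: "deriv \<theta> (u + of_real pi * \<tau>) = - exp (- \<i> * pi * \<tau> - 2 * \<i> * u) * (deriv \<theta> u + - (2 * \<i>) * \<theta> u)" for u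
    proof -
      have "((\<lambda>u. - exp (- \<i> * pi * \<tau> - 2 * \<i> * u) * \<theta> u) has_field_derivative
         - exp (- \<i> * pi * \<tau> - 2 * \<i> * u) * (deriv \<theta> u + - (2 * \<i>) * \<theta> u)) (at u)"
        by (rule derivative_eq_intros \<theta>_deriv refl | simp add: algebra_simps)+
      with deriv_shift[of "of_real pi * \<tau>" u] show ?thesis
        unfolding \<theta>_tau by (rule DERIV_unique)
    qed
    obtain H where H: "H holomorphic_on UNIV"
      "\<And>p z. p \<in> {of_real pi, of_real pi * \<tau>} \<Longrightarrow> H (z + p) = 1 * H z - s p * (\<Sum>k=1..n. F2 (a k) / deriv G (a k))"
    proof (rule theta1_partial_fraction[OF \<tau> F2 G \<phi> simple assms(12,13), of m "\<lambda>_. 1" t s])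
      show "deriv \<theta> 0 = deriv (\<lambda>w. theta1 w \<tau>) 0" by (simp add: \<theta>_def)
      fix p u assume p: "p \<in> {of_real pi, of_real pi * \<tau>}"
      have "F2 (u + of_real pi) = (-1) ^ n * F2 u"
        unfolding F2_def F_pi distrib_left exp_add exp_l by simp
      moreover have "F2 (u + of_real pi * \<tau>) = inverse (\<mu> u) * F2 u"
      proof -
        have "F2 (u + of_real pi * \<tau>) = (e * exp (2 * \<i> * of_int l * (of_real pi * \<tau>))) * (inverse (\<mu> u) * F2 u)"
          unfolding F2_def F_tau distrib_left exp_add by (simp only: mult_ac)
        thus ?thesis unfolding exp_y by simp
      qed
      ultimately show "F2 (u + p) = 1 * m p u * F2 u"
        using p ne by (auto simp: m_def)
      show "G (u + p) = m p u * G u" "theta1 (u + p) \<tau> = t p u * theta1 u \<tau>"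
        "1 \<noteq> (0::complex) \<and> m p u \<noteq> 0 \<and> t p u \<noteq> 0"
        using m[OF p, of u] t[OF p, of u] by (auto simp: \<theta>_def)
      show "deriv \<theta> (u + p) = t p u * (1 * deriv \<theta> u + s p * theta1 u \<tau>)"
        using p ne deriv_pi[of u] deriv_tau[of u] by (auto simp: t_def s_def \<theta>_def)
    qed (use m_cont in auto)
    have "2 * \<i> * S = 0"
    proof (rule additive_entire_increment_zero[OF _ H(1), of \<tau>])
      show "H (u + of_real pi) = H u" "H (u + of_real pi * \<tau>) = H u + 2 * \<i> * S" for u
        using H(2)[of "of_real pi" u] H(2)[of "of_real pi * \<tau>" u] ne by (simp_all add: s_def S_def)
    qed (use \<tau> in auto)
    hence S: "S = 0" by simp
    obtain \<kappa> where \<kappa>: "\<And>u. theta1 (u + y) \<tau> = \<kappa> * exp (- (2 * \<i> * of_int l * u)) * theta1 u \<tau>"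
      using theta1_add_period[OF \<tau>, of j l] unfolding y by blast
    \<comment> \<open>The quotient of theta values is an exponential that splits into a factor
      common to all \<open>k\<close> and the factor turning \<open>F\<close> into \<open>F2\<close>,
      so the sum is a multiple of \<open>S\<close>. The denominators are nonzero because
      \<open>z\<close> is not equivalent to any zero of \<open>G\<close>.\<close>
    have "F (a k) * theta1 (z + y - a k) \<tau> / (deriv G (a k) * theta1 (z - a k) \<tau>) =
        \<kappa> * exp (- (2 * \<i> * of_int l * z)) * (F2 (a k) / deriv G (a k))" if k: "k \<in> {1..n}" for k
    proof -
      have ak: "G (a k) = 0" using assms(13) k by (auto simp: complete_inequivalent_zeros_def)
      have "G (a k + (z - a k)) = 0 \<longleftrightarrow> G (a k) = 0" if "z - a k \<in> period_lattice \<tau>"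
        by (rule period_lattice_induct[OF that, where P = "\<lambda>z. G z = 0"]) (use m in auto)
      hence nz: "theta1 (z - a k) \<tau> \<noteq> 0"
        using Gz ak theta1_eq_0_iff[OF \<tau>] by auto
      have "theta1 (z + y - a k) \<tau> = \<kappa> * exp (- (2 * \<i> * of_int l * (z - a k))) * theta1 (z - a k) \<tau>"
        using \<kappa>[of "z - a k"] by (simp add: diff_add_eq)
      moreover have "exp (- (2 * \<i> * of_int l * (z - a k))) = exp (- (2 * \<i> * of_int l * z)) * exp (2 * \<i> * of_int l * a k)"
        by (simp add: algebra_simps flip: exp_add)
      ultimately show ?thesis using nz by (simp add: F2_def)
    qed
    hence "(\<Sum>k=1..n. F (a k) * theta1 (z + y - a k) \<tau> / (deriv G (a k) * theta1 (z - a k) \<tau>)) =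
        \<kappa> * exp (- (2 * \<i> * of_int l * z)) * S"
      unfolding S_def sum_distrib_left by (rule sum.cong[OF refl])
    thus ?thesis using True S by (simp add: \<theta>_def)
  qed
qed

end
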